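(* Let $L>0$, $\Omega=[0,L]^2$ and $B\in\mathbb{R}^2$ be given, and fix $c_1,c_3>0$, $c_2\in\mathbb{R}$ and $\gamma_0=\exp(-c_2/c_1)$, all independent of $a$. For $a>0$ let the solution space $X$ and the energy $E=E_a$ be as defined in the context. Then there exist positive constants $C_1,C_2$, independent of $a$, such that $$-C_1a^{-2}\le\inf_{h\in X}E[h]\le-C_2a^{-2}\qquad\text{as } a\to0,$$ i.e. for all sufficiently small $a>0$.
   Context: Parameters: $L>0$ (domain size), $a>0$ (lattice constant), $c_1>0$, $c_3>0$, $c_2\in\mathbb{R}$, $\gamma_0=\exp(-c_2/c_1)$, $B\in\mathbb{R}^2$ (average slope). $\Omega=[0,L]^2$ is a periodic cell. $H^1_\#(\Omega)$ denotes the Sobolev space of $\Omega$-periodic functions which, together with their first distributional derivatives, lie in $L^2(\Omega)$. Set $V=\{\tilde h\in H^1_\#(\Omega): \int_\Omega\tilde h\,dx=0\}$ and $X=\{h\in H^1_{\mathrm{loc}}(\mathbb{R}^2): \tilde h(x):=h(x)-B^{\top}x\in V\}$. For $\tilde h\in V$ with Fourier series $\tilde h(x)=\sum_{k\in\mathbb{Z}^2}h_k e^{2\pi i k\cdot x/L}$, define the seminorm $[\tilde h]_{H^{1/2}(\Omega)}=\big(\sum_{k\in\mathbb{Z}^2}|k||h_k|^2\big)^{1/2}$. The energy is $$E[h]=-2c_1\pi^2L\,[\tilde h]_{H^{1/2}(\Omega)}^2+\int_\Omega\Psi(\nabla h)\,dx,\qquad \Psi(p)=ac_1|p|\log(|p|+\gamma_0)+ac_2|p|+ac_3|p|^3,\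 p\in\mathbb{R}^2,$$ with $\tilde h(x)=h(x)-B^\top x$, and the value $+\infty$ when $\nabla h\notin L^3(\Omega)$. *)

theory Defs
  imports "HOL-Analysis.Analysis"
begin

type_synonym plane = "real ^ 2"

definition cell :: "real \<Rightarrow> plane set" where
  "cell L = cbox 0 (\<chi> i. L)"

definition partial :: "2 \<Rightarrow> (plane \<Rightarrow> real) \<Rightarrow> plane \<Rightarrow> real" where
  "partial i f x = frechet_derivative f (at x) (axis i 1)"

text \<open>
  \<open>f\<close> is of class \<open>C\<^sup>n\<close> on the whole plane. Differentiability is required separately because
  \<^const>\<open>frechet_derivative\<close> is unspecified where no derivative exists.
\<close>

primrec Ck :: "nat \<Rightarrow> (plane \<Rightarrow> real) \<Rightarrow> bool" where
  "Ck 0 f \<longleftrightarrow> continuous_on UNIV f"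
| "Ck (Suc n) f \<longleftrightarrow> (\<forall>x. f differentiable (at x)) \<and> (\<forall>i. Ck n (partial i f))"

definition test_function :: "(plane \<Rightarrow> real) \<Rightarrow> bool" where
  "test_function \<phi> \<longleftrightarrow> (\<forall>n. Ck n \<phi>) \<and> compact (closure {x. \<phi> x \<noteq> 0})"

definition locally_integrable :: "(plane \<Rightarrow> 'b::euclidean_space) \<Rightarrow> bool" where
  "locally_integrable f \<longleftrightarrow> (\<forall>K. compact K \<longrightarrow> set_integrable lebesgue K f)"

definition has_weak_gradient :: "(plane \<Rightarrow> real) \<Rightarrow> (plane \<Rightarrow> plane) \<Rightarrow> bool" where
  "has_weak_gradient f G \<longleftrightarrow>
     locally_integrable f \<and> locally_integrable G \<and>
     (\<forall>\<phi> i. test_function \<phi> \<longrightarrow>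
        (LINT x|lebesgue. f x * partial i \<phi> x) = - (LINT x|lebesgue. G x $ i * \<phi> x))"

text \<open>
  Weak gradients are unique only up to null sets; every use below is insensitive to the choice of
  representative.
\<close>

definition weak_gradient :: "(plane \<Rightarrow> real) \<Rightarrow> plane \<Rightarrow> plane" where
  "weak_gradient f = (SOME G. has_weak_gradient f G)"

definition in_Lp :: "nat \<Rightarrow> plane set \<Rightarrow> (plane \<Rightarrow> 'b::euclidean_space) \<Rightarrow> bool" where
  "in_Lp p S f \<longleftrightarrow>
     set_borel_measurable lebesgue S f \<and> set_integrable lebesgue S (\<lambda>x. norm (f x) ^ p)"

text \<open>
  Elements of the Sobolev spaces are represented by arbitrary Lebesgue measurable functions, not by
  equivalence classes, so periodicity is required almost everywhere.
\<close>

definition cell_periodic :: "real \<Rightarrow> (plane \<Rightarrow> real) \<Rightarrow> bool" where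
  "cell_periodic L f \<longleftrightarrow> (\<forall>i. AE x in lebesgue. f (x + axis i L) = f x)"

definition H1_per :: "real \<Rightarrow> (plane \<Rightarrow> real) set" where
  "H1_per L = {f. cell_periodic L f \<and> in_Lp 2 (cell L) f \<and>
     (\<exists>G. has_weak_gradient f G \<and> in_Lp 2 (cell L) G)}"

definition H1_loc :: "(plane \<Rightarrow> real) set" where
  "H1_loc = {f. (\<forall>K. compact K \<longrightarrow> in_Lp 2 K f) \<and>
     (\<exists>G. has_weak_gradient f G \<and> (\<forall>K. compact K \<longrightarrow> in_Lp 2 K G))}"

definition V_space :: "real \<Rightarrow> (plane \<Rightarrow> real) set" where
  "V_space L = {f \<in> H1_per L. (LINT x:cell L|lebesgue. f x) = 0}"

definition detrend :: "plane \<Rightarrow> (plane \<Rightarrow> real) \<Rightarrow> plane \<Rightarrow> real" where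
  "detrend B h = (\<lambda>x. h x - B \<bullet> x)"

definition X_space :: "real \<Rightarrow> plane \<Rightarrow> (plane \<Rightarrow> real) set" where
  "X_space L B = {h \<in> H1_loc. detrend B h \<in> V_space L}"

definition wave_vector :: "int ^ 2 \<Rightarrow> plane" where
  "wave_vector k = (\<chi> i. of_int (k $ i))"

definition fourier_coeff :: "real \<Rightarrow> (plane \<Rightarrow> real) \<Rightarrow> int ^ 2 \<Rightarrow> complex" where
  "fourier_coeff L f k =
     (LINT x:cell L|lebesgue. of_real (f x) * exp (- (2 * pi * \<i> * (wave_vector k \<bullet> x) / L))) / L\<^sup>2"

text \<open>
  The sum below converges for every element of \<^const>\<open>V_space\<close>; \<^const>\<open>infsum\<close> would be \<open>0\<close> otherwise.
\<close>

definition seminorm_H12 :: "real \<Rightarrow> (plane \<Rightarrow> real) \<Rightarrow> real" where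
  "seminorm_H12 L f =
     sqrt (\<Sum>\<^sub>\<infinity>k\<in>UNIV. norm (wave_vector k) * (cmod (fourier_coeff L f k))\<^sup>2)"

definition Psi :: "real \<Rightarrow> real \<Rightarrow> real \<Rightarrow> real \<Rightarrow> real \<Rightarrow> plane \<Rightarrow> real" where
  "Psi c1 c2 c3 \<gamma>0 a p =
     a * c1 * norm p * ln (norm p + \<gamma>0) + a * c2 * norm p + a * c3 * norm p ^ 3"

definition energy ::
  "real \<Rightarrow> plane \<Rightarrow> real \<Rightarrow> real \<Rightarrow> real \<Rightarrow> real \<Rightarrow> real \<Rightarrow> (plane \<Rightarrow> real) \<Rightarrow> ereal" where
  "energy L B c1 c2 c3 \<gamma>0 a h =
     (if in_Lp 3 (cell L) (weak_gradient h)
      then ereal (- 2 * c1 * pi\<^sup>2 * L * (seminorm_H12 L (detrend B h))\<^sup>2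
             + (LINT x:cell L|lebesgue. Psi c1 c2 c3 \<gamma>0 a (weak_gradient h x)))
      else \<infinity>)"

end

theory Submission
  imports Defs
begin

text \<open>
  Since \<open>ln (|p| + \<gamma>\<^sub>0) \<ge> - c\<^sub>2 / c\<^sub>1\<close>, one has \<open>\<Psi>(p) \<ge> a c\<^sub>3 |p|\<^sup>3\<close>. As \<open>|k| \<le> |k|\<^sup>2\<close> on the integer lattice,
  Bessel's inequality for the weak gradient bounds the squared seminorm by
  \<open>(4 \<pi>\<^sup>2)\<^sup>-\<^sup>1 \<integral> |\<nabla>h - B|\<^sup>2\<close>, and the pointwise inequality \<open>A |p|\<^sup>2 \<le> b |p|\<^sup>3 + A\<^sup>3 / b\<^sup>2\<close> with \<open>b = a c\<^sub>3\<close> gives the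
  lower bound. For the upper bound take \<open>h(x) = B \<bullet> x + s cos (2 \<pi> x\<^sub>1 / L)\<close> with \<open>s\<close> a small multiple of
  \<open>1 / a\<close>: the seminorm term is quadratic and the cubic term cubic in that multiple, both being of order
  \<open>a\<^sup>-\<^sup>2\<close>, while the rest of \<open>\<Psi>\<close> contributes only \<open>O(a\<^sup>-\<^sup>1)\<close>.

  The energy uses an arbitrary weak gradient, so weak gradients must be shown to be unique almost
  everywhere, which also makes them periodic; and test functions have compact support, so integration
  by parts over a period needs a partition of unity.
\<close>

subsection \<open>Smooth functions\<close>

text \<open>The exponent -2 comes from a balance of slopes. At slope size p the seminorm can gain a
  multiple of p^2 per unit area, while the cubic term costs a multiple of a p^3. The two balance at
  p of order 1/a, where each is of order a^(-2). The logarithm only has to be kept nonnegative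
  together with the \<open>c2\<close> term for one bound, and of lower order for the other.

  Parseval's identity is avoided. The lower bound on the energy needs the seminorm only from above,
  which Bessel on finite sets of frequencies provides; the upper bound needs it from below, where a
  single coefficient of the competitor suffices. The second estimate still relies on the first:
  \<open>infsum\<close> is 0 on a family that is not summable, and summability comes from the Bessel
  bound.

  Orthogonality of the waves is itself a consequence of integration by parts over a period, applied
  to the constant function 1. All cut-off functions, both for uniqueness and for the partition of
  unity, are assembled from the single profile exp(-1/t); its dilations approximate indicators of
  boxes directly, without convolution.\<close>

primrec Ck_real :: "nat \<Rightarrow> (real \<Rightarrow> real) \<Rightarrow> bool" where
  "Ck_real 0 f \<longleftrightarrow> continuous_on UNIV f"
| "Ck_real (Suc n) f \<longleftrightarrow> (\<exists>f'. (\<forall>t. (f has_real_derivative f' t) (at t)) \<and> Ck_real n f')"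

lemma Ck_real_SucD: "Ck_real (Suc n) f \<Longrightarrow> Ck_real n f"
proof (induction n arbitrary: f)
  case 0
  then show ?case
    by (auto intro: continuous_at_imp_continuous_on DERIV_isCont)
qed (use Ck_real.simps(2) in blast)

lemma Ck_real_const: "Ck_real n (\<lambda>t. c)"
  by (induction n arbitrary: c) (auto intro!: exI[of _ "\<lambda>_. 0"])

lemma Ck_real_add: "Ck_real n f \<Longrightarrow> Ck_real n g \<Longrightarrow> Ck_real n (\<lambda>t. f t + g t)"
proof (induction n arbitrary: f g)
  case 0 then show ?case by (auto intro: continuous_intros)
next
  case (Suc n)
  then obtain f' g' where "\<forall>t. (f has_real_derivative f' t) (at t)" "Ck_real n f'"
    "\<forall>t. (g has_real_derivative g' t) (at t)" "Ck_real n g'" by auto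
  with Suc.IH show ?case
    by (auto intro!: exI[of _ "\<lambda>t. f' t + g' t"] derivative_intros)
qed

lemma Ck_real_mult: "Ck_real n f \<Longrightarrow> Ck_real n g \<Longrightarrow> Ck_real n (\<lambda>t. f t * g t)"
proof (induction n arbitrary: f g)
  case 0 then show ?case by (auto intro: continuous_intros)
next
  case (Suc n)
  then obtain f' g' where *: "\<forall>t. (f has_real_derivative f' t) (at t)" "Ck_real n f'"
    "\<forall>t. (g has_real_derivative g' t) (at t)" "Ck_real n g'" by auto
  have "Ck_real n (\<lambda>t. f' t * g t + g' t * f t)"
    using * Suc.prems by (intro Ck_real_add Suc.IH) (simp_all only: Ck_real_SucD)
  with * show ?case
    by (auto intro!: exI[of _ "\<lambda>t. f' t * g t + g' t * f t"] DERIV_mult)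
qed

lemma Ck_real_affine: "Ck_real n f \<Longrightarrow> Ck_real n (\<lambda>t. f (m * t + d))"
proof (induction n arbitrary: f)
  case 0
  then have "continuous_on UNIV f" by simp
  then show ?case
    by (auto intro!: continuous_on_compose2[of UNIV f] continuous_intros)
next
  case (Suc n)
  then obtain f' where *: "\<And>t. (f has_real_derivative f' t) (at t)" "Ck_real n f'" by auto
  have "Ck_real n (\<lambda>t. m * f' (m * t + d))"
    using * Suc.IH by (intro Ck_real_mult Ck_real_const) auto
  moreover have "((\<lambda>t. f (m * t + d)) has_real_derivative m * f' (m * t + d)) (at t)" for t
    by (rule DERIV_cong[OF DERIV_chain2[OF *(1)]]) (auto intro!: derivative_eq_intros)
  ultimately show ?case by (auto intro!: exI[of _ "\<lambda>t. m * f' (m * t + d)"])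
qed

lemma Ck_real_inverse:
  assumes "Ck_real n f" "\<And>t. f t \<noteq> 0"
  shows "Ck_real n (\<lambda>t. inverse (f t))"
  using assms
proof (induction n arbitrary: f)
  case 0 then show ?case by (auto intro: continuous_intros)
next
  case (Suc n)
  then obtain f' where *: "\<And>t. (f has_real_derivative f' t) (at t)" "Ck_real n f'" by auto
  \<comment> \<open>The derivative of \<open>inverse f\<close> is built from \<open>f'\<close> and
    \<open>inverse f\<close> itself, and the latter is covered at order \<open>n\<close> by the
    induction hypothesis.\<close>
  have "Ck_real n (\<lambda>t. (-1) * (f' t * (inverse (f t) * inverse (f t))))"
    using * Suc by (intro Ck_real_mult Ck_real_const Suc.IH Ck_real_SucD[of n f]) auto
  moreover have "((\<lambda>t. inverse (f t)) has_real_derivative (-1) * (f' t * (inverse (f t) * inverse (f t)))) (at t)" for t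
    by (rule derivative_eq_intros *(1) refl Suc.prems | simp add: algebra_simps)+
  ultimately show ?case
    by (auto intro!: exI[of _ "\<lambda>t. - (f' t * (inverse (f t) * inverse (f t)))"])
qed

lemma Ck_real_sin_cos: "Ck_real n sin \<and> Ck_real n cos"
proof (induction n)
  case 0 then show ?case by (auto intro: continuous_intros)
next
  case (Suc n)
  have "Ck_real n (\<lambda>t. (-1) * sin t)" using Suc by (intro Ck_real_mult Ck_real_const) auto
  then have "Ck_real n (\<lambda>t. - sin t)" by simp
  with Suc show ?case
    unfolding Ck_real.simps by (intro conjI exI[of _ cos] exI[of _ "\<lambda>t. - sin t"] allI) auto
qed

text \<open>
  Functions \<open>p(1/t) exp(-1/t)\<close> for all polynomials \<open>p\<close> at once, because this family is closed
  under differentiation.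
\<close>

definition flat :: "real poly \<Rightarrow> real \<Rightarrow> real" where
  "flat p t = (if t \<le> 0 then 0 else poly p (1 / t) * exp (- 1 / t))"

lemma poly_times_exp_tendsto_0: "((\<lambda>y::real. poly p y * exp (- y)) \<longlongrightarrow> 0) at_top"
proof -
  have "((\<lambda>y::real. \<Sum>i\<le>degree p. coeff p i * (y ^ i / exp y)) \<longlongrightarrow> (\<Sum>i\<le>degree p. coeff p i * 0)) at_top"
    by (intro tendsto_intros tendsto_power_div_exp_0)
  then show ?thesis
    by (simp add: poly_altdef exp_minus divide_inverse sum_distrib_right mult.assoc)
qed

lemma flat_tendsto_0: "(flat p \<longlongrightarrow> 0) (at 0)"
proof -
  have r: "(flat p \<longlongrightarrow> 0) (at_right 0)"
  proof (rule Lim_transform_eventually)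
    show "((\<lambda>t. poly p (inverse t) * exp (- inverse t)) \<longlongrightarrow> 0) (at_right 0)"
      using poly_times_exp_tendsto_0 filterlim_inverse_at_top_right filterlim_compose by blast
    show "\<forall>\<^sub>F t in at_right 0. poly p (inverse t) * exp (- inverse t) = flat p t"
      by (auto simp: eventually_at_right_field flat_def divide_inverse intro: exI[of _ 1])
  qed
  have "(flat p \<longlongrightarrow> 0) (at_left 0)"
    by (rule Lim_transform_eventually[OF tendsto_const])
       (auto simp: eventually_at_left_field flat_def intro: exI[of _ "-1"])
  with r show ?thesis by (simp add: filterlim_at_split)
qed

text \<open>With y = 1/t one has d/dt = -y^2 d/dy, and d/dy (p(y) exp(-y)) = (p' - p)(y) exp(-y);
  hence the new polynomial y^2 (p - p').\<close>

lemma flat_DERIV: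
  "(flat p has_real_derivative flat ([:0, 0, 1:] * (p - pderiv p)) t) (at t)"
proof -
  consider "t < 0" | "t = 0" | "t > 0" by linarith
  then show ?thesis
  proof cases
    case 1
    have "((\<lambda>t. 0) has_real_derivative flat ([:0, 0, 1:] * (p - pderiv p)) t) (at t)"
      using 1 by (auto simp: flat_def)
    then show ?thesis
      by (rule DERIV_cong_ev[THEN iffD1, rotated -1])
         (use 1 in \<open>auto simp: flat_def eventually_nhds intro!: exI[of _ "{..<0}"]\<close>)
  next
    case 2
    \<comment> \<open>Dividing by \<open>h\<close> multiplies the polynomial by y = 1/h, so the
      difference quotient at 0 stays in the family and tends to 0.\<close>
    have "(\<lambda>h. (flat p h - flat p 0) / h) = flat (pCons 0 p)"
      by (auto simp: flat_def fun_eq_iff)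
    then show ?thesis
      using 2 flat_tendsto_0[of "pCons 0 p"] by (simp add: DERIV_def flat_def)
  next
    case 3
    have "((\<lambda>t. poly p (1 / t) * exp (- 1 / t)) has_real_derivative
        flat ([:0, 0, 1:] * (p - pderiv p)) t) (at t)"
      using 3 by (auto intro!: derivative_eq_intros DERIV_chain2[OF poly_DERIV]
          simp: flat_def field_simps power2_eq_square)
    then show ?thesis
      by (rule DERIV_cong_ev[THEN iffD1, rotated -1])
         (use 3 in \<open>auto simp: flat_def eventually_nhds intro!: exI[of _ "{0<..}"]\<close>)
  qed
qed

lemma Ck_real_flat: "Ck_real n (flat p)"
proof (induction n arbitrary: p)
  case 0
  then show ?case using flat_DERIV by (auto intro!: DERIV_continuous_on)
next
  case (Suc n)
  then show ?case using flat_DERIV by (auto intro!: exI[of _ "flat ([:0, 0, 1:] * (p - pderiv p))"])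
qed

abbreviation flat1 :: "real \<Rightarrow> real" where "flat1 \<equiv> flat 1"

lemma flat1_eq: "flat1 t = (if t \<le> 0 then 0 else exp (- 1 / t))"
  by (simp add: flat_def)

definition smooth_step :: "real \<Rightarrow> real" where
  "smooth_step t = flat1 t * inverse (flat1 t + flat1 (1 - t))"

lemma Ck_real_smooth_step: "Ck_real n smooth_step"
proof -
  have "Ck_real n (\<lambda>t. flat1 (1 - t))" using Ck_real_affine[OF Ck_real_flat, of n 1 "-1" 1] by simp
  moreover have "flat1 t + flat1 (1 - t) \<noteq> 0" for t
    by (cases "t \<le> 0"; cases "1 - t \<le> 0")
       (simp_all add: flat1_eq, smt (verit) exp_gt_zero)
  ultimately show ?thesis
    unfolding smooth_step_def[abs_def] by (intro Ck_real_mult Ck_real_flat Ck_real_inverse Ck_real_add)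
qed

lemma smooth_step_eq: "t \<le> 0 \<Longrightarrow> smooth_step t = 0" "t \<ge> 1 \<Longrightarrow> smooth_step t = 1"
  by (auto simp: smooth_step_def flat1_eq)

section \<open>Smooth functions of two variables\<close>

definition smooth :: "(plane \<Rightarrow> real) \<Rightarrow> bool" where
  "smooth f \<longleftrightarrow> (\<forall>n. Ck n f)"

lemma partial_eq: "(f has_derivative D) (at x) \<Longrightarrow> partial i f x = D (axis i 1)"
  unfolding partial_def by (metis frechet_derivative_at)

lemma partial_eq_0_outside:
  assumes "closed S" "\<And>x. x \<notin> S \<Longrightarrow> f x = 0" "x \<notin> S"
  shows "partial i f x = 0"
proof -
  have "(f has_derivative (\<lambda>h. 0)) (at x)"
    by (rule has_derivative_transform_within_open[OF has_derivative_const, of "- S" _ 0])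
       (use assms in auto)
  then show ?thesis by (simp add: partial_eq)
qed

lemma Ck_SucD: "Ck (Suc n) f \<Longrightarrow> Ck n f"
proof (induction n arbitrary: f)
  case 0
  then show ?case
    by (auto intro!: differentiable_imp_continuous_on differentiable_at_imp_differentiable_on)
qed (use Ck.simps(2) in blast)

lemma partial_add:
  "f differentiable (at x) \<Longrightarrow> g differentiable (at x) \<Longrightarrow>
   partial i (\<lambda>x. f x + g x) x = partial i f x + partial i g x"
  by (subst partial_eq[OF has_derivative_add]) 
     (auto simp: frechet_derivative_works[symmetric] partial_def)

lemma partial_mult:
  "f differentiable (at x) \<Longrightarrow> g differentiable (at x) \<Longrightarrow>
   partial i (\<lambda>x. f x * g x) x = f x * partial i g x + partial i f x * g x"
  by (subst partial_eq[OF has_derivative_mult])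
     (auto simp: frechet_derivative_works[symmetric] partial_def)

lemma Ck_const: "Ck n (\<lambda>x. c)"
proof (induction n arbitrary: c)
  case (Suc n)
  have "partial i (\<lambda>x. c) = (\<lambda>x. 0)" for i
    by (rule ext, subst partial_eq[OF has_derivative_const]) auto
  with Suc show ?case by auto
qed auto

lemma Ck_add: "Ck n f \<Longrightarrow> Ck n g \<Longrightarrow> Ck n (\<lambda>x. f x + g x)"
proof (induction n arbitrary: f g)
  case 0 then show ?case by (auto intro: continuous_intros)
next
  case (Suc n)
  then have "partial i (\<lambda>x. f x + g x) = (\<lambda>x. partial i f x + partial i g x)" for i
    by (auto simp: partial_add)
  with Suc show ?case by auto
qed

lemma Ck_mult: "Ck n f \<Longrightarrow> Ck n g \<Longrightarrow> Ck n (\<lambda>x. f x * g x)"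
proof (induction n arbitrary: f g)
  case 0 then show ?case by (auto intro: continuous_intros)
next
  case (Suc n)
  then have "partial i (\<lambda>x. f x * g x) = (\<lambda>x. f x * partial i g x + partial i f x * g x)" for i
    by (auto simp: partial_mult)
  moreover have "Ck n f" "Ck n g" using Suc.prems Ck_SucD by blast+
  ultimately show ?case using Suc by (auto intro!: Ck_add Suc.IH)
qed

text \<open>Every concrete smooth function below (bumps in a coordinate, sine and cosine waves,
  linear functions) is a sum or product of constants and ridge functions, so two-dimensional
  smoothness reduces to \<open>Ck_real\<close>.\<close>

lemma ridge_has_derivative:
  assumes "\<And>t. (f has_real_derivative f' t) (at t)"
  shows "((\<lambda>x::plane. f (v \<bullet> x + d)) has_derivative (\<lambda>h. f' (v \<bullet> x + d) * (v \<bullet> h))) (at x)"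
  by (rule has_derivative_eq_rhs, rule has_derivative_compose[of "\<lambda>x. v \<bullet> x + d" "\<lambda>h. v \<bullet> h"])
     (auto intro!: derivative_eq_intros assms[unfolded has_field_derivative_def])

lemma partial_ridge:
  assumes "\<And>t. (f has_real_derivative f' t) (at t)"
  shows "partial i (\<lambda>x::plane. f (v \<bullet> x + d)) x = f' (v \<bullet> x + d) * v $ i"
  by (subst partial_eq[OF ridge_has_derivative[OF assms]]) (simp add: inner_axis)

lemma Ck_ridge: "Ck_real n f \<Longrightarrow> Ck n (\<lambda>x. f (v \<bullet> x + d))"
proof (induction n arbitrary: f)
  case 0
  then have "continuous_on UNIV f" by simp
  then show ?case
    by (auto intro!: continuous_on_compose2[of UNIV f] continuous_intros)
next
  case (Suc n)
  then obtain f' where *: "\<And>t. (f has_real_derivative f' t) (at t)" "Ck_real n f'" by auto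
  have "partial i (\<lambda>x. f (v \<bullet> x + d)) = (\<lambda>x. f' (v \<bullet> x + d) * v $ i)" for i
    by (rule ext) (rule partial_ridge[OF *(1)])
  moreover have "Ck n (\<lambda>x. f' (v \<bullet> x + d) * v $ i)" for i
    using * Suc.IH by (intro Ck_mult Ck_const) auto
  moreover have "(\<lambda>x. f (v \<bullet> x + d)) differentiable (at x)" for x
    using ridge_has_derivative[OF *(1)] unfolding differentiable_def by blast
  ultimately show ?case by auto
qed

lemma smooth_mult: "smooth f \<Longrightarrow> smooth g \<Longrightarrow> smooth (\<lambda>x. f x * g x)"
  and smooth_add: "smooth f \<Longrightarrow> smooth g \<Longrightarrow> smooth (\<lambda>x. f x + g x)"
  and smooth_const: "smooth (\<lambda>x. c)"
  by (auto simp: smooth_def Ck_mult Ck_add Ck_const)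

lemma smooth_ridge: "(\<And>n. Ck_real n f) \<Longrightarrow> smooth (\<lambda>x. f (v \<bullet> x + d))"
  by (auto simp: smooth_def Ck_ridge)

lemma smooth_coord: "(\<And>n. Ck_real n f) \<Longrightarrow> smooth (\<lambda>x. f (m * x $ i + d))"
  using smooth_ridge[of f "axis i m" d] by (simp add: inner_axis')

lemma smooth_partial: "smooth f \<Longrightarrow> smooth (partial i f)"
  unfolding smooth_def by (metis Ck.simps(2))

lemma smooth_differentiable: "smooth f \<Longrightarrow> f differentiable (at x)"
  unfolding smooth_def by (metis Ck.simps(2))

lemma smooth_continuous: "smooth f \<Longrightarrow> continuous_on S f"
  unfolding smooth_def by (metis Ck.simps(1) continuous_on_subset top_greatest)

lemma test_functionI:
  assumes "smooth f" "bounded S" "\<And>x. x \<notin> S \<Longrightarrow> f x = 0"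
  shows "test_function f"
proof -
  have "{x. f x \<noteq> 0} \<subseteq> S" using assms(3) by auto
  then have "bounded {x. f x \<noteq> 0}" using assms(2) bounded_subset by blast
  then show ?thesis
    using assms(1) by (auto simp: test_function_def smooth_def)
qed

lemma test_function_smooth: "test_function f \<Longrightarrow> smooth f"
  by (auto simp: test_function_def smooth_def)

lemma test_function_bounded_support:
  assumes "test_function f"
  obtains S where "compact S" "\<And>x. x \<notin> S \<Longrightarrow> f x = 0"
  using assms unfolding test_function_def
  by (metis (mono_tags, lifting) closure_subset mem_Collect_eq subsetD)

subsection \<open>Translations and integration by parts\<close>

lemma
  fixes v :: "'a::euclidean_space"
  shows lebesgue_translation_measurable: "(\<lambda>x. x + v) \<in> lebesgue \<rightarrow>\<^sub>M lebesgue"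
    and lebesgue_distr_translation: "distr lebesgue lebesgue (\<lambda>x. x + v) = lebesgue"
  using lebesgue_affine_measurable[of "\<lambda>_. 1" v] lebesgue_affine_euclidean[of "\<lambda>_. 1" v]
  by (simp_all add: euclidean_representation add.commute[of v] density_1)

lemma borel_measurable_translation:
  fixes v :: "'a::euclidean_space"
  assumes "f \<in> borel_measurable lebesgue"
  shows "(\<lambda>x. f (x + v)) \<in> borel_measurable lebesgue"
  using measurable_compose[OF lebesgue_translation_measurable assms] .

lemma
  fixes v :: "'a::euclidean_space" and f :: "'a \<Rightarrow> 'b::{banach, second_countable_topology}"
  assumes "f \<in> borel_measurable lebesgue"
  shows integral_translation: "(LINT x|lebesgue. f (x + v)) = (LINT x|lebesgue. f x)"
    and integrable_translation: "integrable lebesgue (\<lambda>x. f (x + v)) \<longleftrightarrow> integrable lebesgue f"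
  using integral_distr[OF lebesgue_translation_measurable assms, of v]
    integrable_distr_eq[OF lebesgue_translation_measurable assms, of v]
  by (simp_all add: lebesgue_distr_translation)

section \<open>Measurability and local integrability\<close>

lemma continuous_lebesgue_measurable:
  fixes f :: "'a::euclidean_space \<Rightarrow> 'b::real_normed_vector"
  assumes "continuous_on UNIV f"
  shows "f \<in> borel_measurable lebesgue"
  using borel_measurable_continuous_onI[OF assms] by (intro measurable_completion) simp

lemma set_integrable_continuous_compact:
  fixes f :: "'a::euclidean_space \<Rightarrow> 'b::{banach, second_countable_topology}"
  assumes "continuous_on S f" "compact S"
  shows "set_integrable lebesgue S f"
proof -
  have "integrable lborel (\<lambda>x. indicator S x *\<^sub>R f x)"
    using borel_integrable_compact assms by blast
  then show ?thesis
    unfolding set_integrable_def by (subst integrable_completion) (auto simp: borel_measurable_integrable)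
qed

text \<open>\<open>locally_integrable\<close> only speaks about compact sets; the truncations to
  balls are measurable and at each point eventually equal to \<open>f\<close>.\<close>

lemma locally_integrable_measurable:
  assumes "locally_integrable f"
  shows "f \<in> borel_measurable lebesgue"
proof (rule borel_measurable_LIMSEQ_metric)
  fix n :: nat
  show "(\<lambda>x. indicat_real (cball 0 (real n)) x *\<^sub>R f x) \<in> borel_measurable lebesgue"
    using assms unfolding locally_integrable_def set_integrable_def
    by (intro borel_measurable_integrable) auto
next
  fix x :: plane
  obtain N where "norm x \<le> real N" using real_arch_simple by blast
  then have "\<forall>\<^sub>F n in sequentially. indicat_real (cball 0 (real n)) x *\<^sub>R f x = f x"
    by (auto simp: eventually_sequentially intro!: exI[of _ N])
  then show "(\<lambda>n. indicat_real (cball 0 (real n)) x *\<^sub>R f x) \<longlonglongrightarrow> f x"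
    by (rule tendsto_eventually)
qed

lemma continuous_locally_integrable:
  "continuous_on UNIV f \<Longrightarrow> locally_integrable f"
  unfolding locally_integrable_def
  by (meson continuous_on_subset set_integrable_continuous_compact subset_UNIV)

lemma integrable_mult_bounded:
  fixes f :: "'a \<Rightarrow> real"
  assumes "set_integrable M K f" "g \<in> borel_measurable M" "\<And>x. x \<in> K \<Longrightarrow> \<bar>g x\<bar> \<le> C"
    and "f \<in> borel_measurable M" "\<And>x. x \<notin> K \<Longrightarrow> g x = 0"
  shows "integrable M (\<lambda>x. f x * g x)"
proof (rule Bochner_Integration.integrable_bound)
  show "integrable M (\<lambda>x. C * (indicator K x *\<^sub>R f x))"
    using assms(1) by (intro integrable_mult_right) (auto simp: set_integrable_def)
  show "(\<lambda>x. f x * g x) \<in> borel_measurable M" using assms by measurable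
  show "AE x in M. norm (f x * g x) \<le> norm (C * (indicator K x *\<^sub>R f x))"
  proof (rule AE_I2)
    fix x 
    have "\<bar>f x\<bar> * \<bar>g x\<bar> \<le> \<bar>C\<bar> * \<bar>f x\<bar>" if "x \<in> K"
      using assms(3)[OF that] by (subst mult.commute) (intro mult_right_mono, auto)
    with assms(5) show "norm (f x * g x) \<le> norm (C * (indicator K x *\<^sub>R f x))"
      by (cases "x \<in> K") (auto simp: abs_mult)
  qed
qed

lemma integrable_locally_integrable_mult:
  fixes f :: "plane \<Rightarrow> real"
  assumes "locally_integrable f" "continuous_on UNIV g" "compact K" "\<And>x. x \<notin> K \<Longrightarrow> g x = 0"
  shows "integrable lebesgue (\<lambda>x. f x * g x)"
proof -
  have "bounded (g ` K)"
    using assms by (meson compact_continuous_image compact_imp_bounded continuous_on_subset top_greatest)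
  then obtain C where C: "\<And>x. x \<in> K \<Longrightarrow> \<bar>g x\<bar> \<le> C" by (auto simp: bounded_iff)
  show ?thesis
    using assms C by (intro integrable_mult_bounded[where K=K and C=C])
      (auto simp: locally_integrable_def locally_integrable_measurable continuous_lebesgue_measurable)
qed

lemma integrable_continuous_compact_support:
  fixes g :: "plane \<Rightarrow> real"
  assumes "continuous_on UNIV g" "compact K" "\<And>x. x \<notin> K \<Longrightarrow> g x = 0"
  shows "integrable lebesgue g"
  using integrable_locally_integrable_mult[of "\<lambda>x. 1" g K] assms
  by (simp add: continuous_locally_integrable)

lemma partial_line_derivative:
  assumes "f differentiable (at (x + s *\<^sub>R axis i 1))"
  shows "((\<lambda>s. f (x + s *\<^sub>R axis i 1)) has_real_derivative partial i f (x + s *\<^sub>R axis i 1)) (at s)"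
proof -
  let ?D = "frechet_derivative f (at (x + s *\<^sub>R axis i 1))"
  have D: "(f has_derivative ?D) (at (x + s *\<^sub>R axis i 1))"
    using assms frechet_derivative_works by blast
  have "((\<lambda>s. f (x + s *\<^sub>R axis i 1)) has_derivative (\<lambda>h. ?D (h *\<^sub>R axis i 1))) (at s)"
    by (rule has_derivative_compose[of "\<lambda>s. x + s *\<^sub>R axis i 1" "\<lambda>h. h *\<^sub>R axis i 1", OF _ D])
       (auto intro!: derivative_eq_intros)
  moreover have "?D (h *\<^sub>R axis i 1) = partial i f (x + s *\<^sub>R axis i 1) * h" for h
    using linear_scale[OF has_derivative_linear[OF D]] by (simp add: partial_def)
  ultimately show ?thesis by (simp add: has_field_derivative_def)
qed

text \<open>The difference quotients of \<open>u\<close> have integral zero by translation invariance and converge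
  boundedly to \<open>partial i u\<close>.\<close>

lemma integral_partial_eq_0:
  assumes u: "smooth u" and S: "compact S" "\<And>x. x \<notin> S \<Longrightarrow> u x = 0"
  shows "(LINT x|lebesgue. partial i u x) = 0"
proof -
  define e :: plane where "e = axis i 1"
  define s where "s n = inverse (real (Suc n))" for n
  define q where "q n x = (u (x + s n *\<^sub>R e) - u x) / s n" for n x
  have s: "0 < s n" "s n \<le> 1" for n by (auto simp: s_def divide_simps)
  obtain R where R: "\<And>x. x \<in> S \<Longrightarrow> norm x \<le> R"
    using compact_imp_bounded[OF S(1)] by (auto simp: bounded_iff)
  have cont: "continuous_on UNIV u" "continuous_on UNIV (partial i u)"
    using u by (auto simp: smooth_continuous smooth_partial)
  have "bounded (partial i u ` cball 0 (R + 2))"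
    by (meson cont(2) compact_cball compact_continuous_image compact_imp_bounded continuous_on_subset top_greatest)
  then obtain C where C: "\<And>x. norm x \<le> R + 2 \<Longrightarrow> \<bar>partial i u x\<bar> \<le> C"
    unfolding bounded_iff by (metis image_eqI mem_cball_0 real_norm_def)
  have int_u: "integrable lebesgue u"
    using integrable_continuous_compact_support[OF cont(1) S] .
  have meas_u: "u \<in> borel_measurable lebesgue" using int_u by auto
  have int_shift: "integrable lebesgue (\<lambda>x. u (x + s n *\<^sub>R e))" for n
    using integrable_translation[OF meas_u] int_u by blast
  have q0: "(LINT x|lebesgue. q n x) = 0" for n
    using integral_translation[OF meas_u, of "s n *\<^sub>R e"] int_shift int_u by (simp add: q_def)
  have lim: "(\<lambda>n. q n x) \<longlonglongrightarrow> partial i u x" for x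
  proof -
    have "((\<lambda>t. u (x + t *\<^sub>R e)) has_real_derivative partial i u x) (at 0)"
      using partial_line_derivative[of u x 0 i] u by (simp add: smooth_differentiable e_def)
    then have "(\<lambda>t. (u (x + t *\<^sub>R e) - u x) / t) \<midarrow>0\<rightarrow> partial i u x"
      by (simp add: DERIV_def)
    moreover have "filterlim s (at 0) sequentially"
      unfolding filterlim_at s_def using LIMSEQ_inverse_real_of_nat by (auto simp: s_def)
    ultimately show ?thesis unfolding q_def by (rule filterlim_compose)
  qed
  \<comment> \<open>Inside the ball of radius R + 1 the mean value theorem makes the quotient a
    value of \<open>partial i u\<close> at distance less than 1 from \<open>x\<close>. Outside it
    both values of \<open>u\<close> vanish, because the step is at most 1.\<close>
  have bound: "norm (q n x) \<le> C * indicator (cball 0 (R + 1)) x" for n x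
  proof (cases "norm x \<le> R + 1")
    case True
    obtain z where z: "0 < z" "z < s n"
      "u (x + s n *\<^sub>R e) - u (x + 0 *\<^sub>R e) = (s n - 0) * partial i u (x + z *\<^sub>R e)"
      using MVT2[OF s(1)[of n], of "\<lambda>t. u (x + t *\<^sub>R e)" "\<lambda>t. partial i u (x + t *\<^sub>R e)"]
        partial_line_derivative[of u x _ i] u by (auto simp: smooth_differentiable e_def)
    then have "q n x = partial i u (x + z *\<^sub>R e)" using s(1)[of n] by (simp add: q_def)
    moreover have "norm (x + z *\<^sub>R e) \<le> R + 2"
      using z s(2)[of n] True norm_triangle_ineq[of x "z *\<^sub>R e"] by (simp add: e_def)
    ultimately show ?thesis using True C by simp
  next
    case False
    have "norm x \<le> norm (x + s n *\<^sub>R e) + norm (s n *\<^sub>R e)" by (metis add_diff_cancel norm_triangle_sub add.commute norm_triangle_ineq4)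
    then have "norm x \<le> norm (x + s n *\<^sub>R e) + 1" using s[of n] by (simp add: e_def)
    with False have "x \<notin> S" "x + s n *\<^sub>R e \<notin> S" using R[of x] R[of "x + s n *\<^sub>R e"] by auto
    then show ?thesis using False S by (simp add: q_def)
  qed
  have "(\<lambda>n. LINT x|lebesgue. q n x) \<longlonglongrightarrow> (LINT x|lebesgue. partial i u x)"
  proof (rule integral_dominated_convergence[where w="\<lambda>x. C * indicator (cball 0 (R + 1)) x"])
    show "partial i u \<in> borel_measurable lebesgue" using cont continuous_lebesgue_measurable by blast
    show "q n \<in> borel_measurable lebesgue" for n
      unfolding q_def using meas_u borel_measurable_translation[OF meas_u] by simp
    show "integrable lebesgue (\<lambda>x. C * indicator (cball 0 (R + 1)) x :: real)"
      by (intro integrable_mult_right integrable_real_indicator) (use emeasure_lborel_cball_finite in auto)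
  qed (use lim bound in auto)
  with q0 show ?thesis by (simp add: LIMSEQ_const_iff)
qed

definition grad :: "(plane \<Rightarrow> real) \<Rightarrow> plane \<Rightarrow> plane" where
  "grad f x = (\<chi> i. partial i f x)"

lemma continuous_grad: "smooth f \<Longrightarrow> continuous_on S (grad f)"
  unfolding grad_def by (intro continuous_on_vec_lambda) (auto intro: smooth_continuous smooth_partial)

text \<open>The product of \<open>f\<close> with a test function is smooth with compact support, so
  the integral of its partial derivative is 0; the product rule splits this into the two
  sides.\<close>

lemma smooth_has_weak_gradient:
  assumes f: "smooth f"
  shows "has_weak_gradient f (grad f)"
  unfolding has_weak_gradient_def
proof (intro conjI allI impI)
  show "locally_integrable f" using f continuous_locally_integrable smooth_continuous by blast
  show "locally_integrable (grad f)"
    using f continuous_locally_integrable continuous_grad by blast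
  fix \<phi> :: "plane \<Rightarrow> real" and i assume \<phi>: "test_function \<phi>"
  obtain S where S: "compact S" "\<And>x. x \<notin> S \<Longrightarrow> \<phi> x = 0"
    using test_function_bounded_support[OF \<phi>] by metis
  have sm: "smooth \<phi>" using \<phi> test_function_smooth by blast
  have d\<phi>: "partial i \<phi> x = 0" if "x \<notin> S" for x
    by (rule partial_eq_0_outside[of S \<phi> x i, OF compact_imp_closed[OF S(1)] S(2) that])
  have "integrable lebesgue (\<lambda>x. f x * partial i \<phi> x)"
    by (rule integrable_locally_integrable_mult[of _ _ S])
       (use f sm d\<phi> S in \<open>auto intro!: continuous_locally_integrable smooth_continuous smooth_partial\<close>)
  moreover have "integrable lebesgue (\<lambda>x. partial i f x * \<phi> x)"
    by (rule integrable_locally_integrable_mult[of _ _ S])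
       (use f sm S in \<open>auto intro!: continuous_locally_integrable smooth_continuous smooth_partial\<close>)
  moreover have "(LINT x|lebesgue. partial i (\<lambda>x. f x * \<phi> x) x) = 0"
    by (rule integral_partial_eq_0[of _ S]) (use f sm S in \<open>auto intro: smooth_mult\<close>)
  moreover have "partial i (\<lambda>x. f x * \<phi> x) = (\<lambda>x. f x * partial i \<phi> x + partial i f x * \<phi> x)"
    using f sm by (auto simp: partial_mult smooth_differentiable)
  ultimately show "(LINT x|lebesgue. f x * partial i \<phi> x) = - (LINT x|lebesgue. grad f x $ i * \<phi> x)"
    by (simp add: grad_def)
qed

subsection \<open>Uniqueness of weak gradients\<close>

lemma flat1_bounds: "0 \<le> flat1 t" "flat1 t \<le> 1"
  by (auto simp: flat1_eq)

text \<open>The limit at t = 0 is 0 since \<open>flat1\<close> vanishes there. The dilations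
  therefore approach the indicator of the open half-line at every point, which makes the open box
  the limit of the bumps below.\<close>

lemma flat1_dilation_tendsto:
  "(\<lambda>n. flat1 (real (Suc n) * t)) \<longlonglongrightarrow> (if t > 0 then 1 else 0)"
proof (cases "t > 0")
  case True
  have "(\<lambda>n. exp (- 1 / t * inverse (real (Suc n)))) \<longlonglongrightarrow> exp (- 1 / t * 0)"
    by (intro tendsto_intros LIMSEQ_inverse_real_of_nat)
  moreover have "exp (- 1 / t * inverse (real (Suc n))) = flat1 (real (Suc n) * t)" for n
    using True mult_pos_pos[of "real (Suc n)" t] by (auto simp: flat1_eq not_le[symmetric] field_simps)
  ultimately show ?thesis using True by simp
qed (simp add: flat1_eq mult_nonneg_nonpos)

text \<open>One dilated \<open>flat1\<close> factor for the signed distance to each of the four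
  sides: test functions that are bounded by the indicator of the open box and converge to it
  pointwise.\<close>

definition box_bump :: "plane \<Rightarrow> plane \<Rightarrow> nat \<Rightarrow> plane \<Rightarrow> real" where
  "box_bump a b n x = (flat1 (real (Suc n) * (x $ 1 - a $ 1)) * flat1 (real (Suc n) * (b $ 1 - x $ 1))) *
     (flat1 (real (Suc n) * (x $ 2 - a $ 2)) * flat1 (real (Suc n) * (b $ 2 - x $ 2)))"

lemma box_bump_bounds: "\<bar>box_bump a b n x\<bar> \<le> indicator (box a b) x"
proof (cases "x \<in> box a b")
  case True
  have "\<bar>box_bump a b n x\<bar> \<le> (1 * 1) * (1 * 1)"
    unfolding box_bump_def abs_mult by (intro mult_mono) (auto simp: flat1_bounds)
  with True show ?thesis by simp
next
  case False
  then have "box_bump a b n x = 0"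
    by (auto simp: mem_box_cart forall_2 box_bump_def flat1_eq mult_nonneg_nonpos not_less)
  then show ?thesis by simp
qed

lemma box_bump_tendsto: "(\<lambda>n. box_bump a b n x) \<longlonglongrightarrow> indicator (box a b) x"
proof -
  have "indicat_real (box a b) x = ((if x $ 1 - a $ 1 > 0 then 1 else 0) * (if b $ 1 - x $ 1 > 0 then 1 else 0))
      * ((if x $ 2 - a $ 2 > 0 then 1 else 0) * (if b $ 2 - x $ 2 > 0 then 1 else 0))"
    by (auto simp: indicator_def mem_box_cart forall_2)
  then show ?thesis
    unfolding box_bump_def by (simp only:) (intro tendsto_mult flat1_dilation_tendsto)
qed

lemma test_function_box_bump: "test_function (box_bump a b n)"
proof (rule test_functionI[of _ "box a b"])
  have f: "smooth (\<lambda>x. flat1 (real (Suc n) * (x $ i - a $ i)))" for i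
    using smooth_coord[OF Ck_real_flat, of 1 "real (Suc n)" i "- (real (Suc n) * a $ i)"]
    by (simp add: algebra_simps)
  have g: "smooth (\<lambda>x. flat1 (real (Suc n) * (b $ i - x $ i)))" for i
    using smooth_coord[OF Ck_real_flat, of 1 "- real (Suc n)" i "real (Suc n) * b $ i"]
    by (simp add: algebra_simps)
  show "smooth (box_bump a b n)"
    unfolding box_bump_def[abs_def] by (intro smooth_mult f g)
  show "box_bump a b n x = 0" if "x \<notin> box a b" for x
    using box_bump_bounds[of a b n x] that by simp
qed auto

text \<open>A pi-lambda argument: open boxes are stable under intersection and generate the Borel
  sets. The whole space is not a box, so closure under complements rests on the assumption
  \<open>all\<close>.\<close>

lemma AE_eq_0_if_box_integrals_eq_0:
  fixes f :: "'a::euclidean_space \<Rightarrow> real"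
  assumes f: "integrable lborel f"
    and box: "\<And>a b. (LINT x:box a b|lborel. f x) = 0" and all: "(LINT x|lborel. f x) = 0"
  shows "AE x in lborel. f x = 0"
proof (rule sigma_finite_measure.density_zero[OF sigma_finite_lborel f])
  fix A :: "'a set" assume "A \<in> sets lborel"
  then have A: "A \<in> sigma_sets UNIV (range (\<lambda>(a, b). box a b :: 'a set))"
    by (simp add: borel_eq_box)
  have set_int: "set_integrable lborel C f" if "C \<in> sets borel" for C
    unfolding set_integrable_def using integrable_mult_indicator[of C lborel f] that f by simp
  have borel: "C \<in> sets borel" if "C \<in> sigma_sets UNIV (range (\<lambda>(a, b). box a b :: 'a set))" for C
    using that by (simp add: borel_eq_box)
  have stable: "Int_stable (range (\<lambda>(a, b). box a b :: 'a set))"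
    unfolding Int_stable_def
  proof (intro ballI)
    fix X Y :: "'a set" assume "X \<in> range (\<lambda>(a, b). box a b)" "Y \<in> range (\<lambda>(a, b). box a b)"
    then obtain a b c d where "X = box a b" "Y = box c d" by auto
    \<comment> \<open>The witness takes the coordinatewise maximum of the lower corners and minimum
      of the upper corners; an empty intersection is still a box.\<close>
    then have "X \<inter> Y = (\<lambda>(a, b). box a b) (\<Sum>i\<in>Basis. max (a\<bullet>i) (c\<bullet>i) *\<^sub>R i, \<Sum>i\<in>Basis. min (b\<bullet>i) (d\<bullet>i) *\<^sub>R i)"
      by (simp add: box_Int_box)
    then show "X \<inter> Y \<in> range (\<lambda>(a, b). box a b)" by blast
  qed
  have sub: "range (\<lambda>(a, b). box a b :: 'a set) \<subseteq> Pow UNIV" by simp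
  show "(LINT x:A|lborel. f x) = 0"
    using stable sub A
  proof (induction rule: sigma_sets_induct_disjoint)
    case (basic C)
    then show ?case using box by auto
  next
    case empty
    then show ?case by (simp add: set_lebesgue_integral_def)
  next
    case (compl C)
    have C: "C \<in> sets borel" using borel compl(1) by blast
    have D: "UNIV - C \<in> sets borel" using borel_comp[OF C] by (simp add: Compl_eq_Diff_UNIV)
    have "(LINT x:C \<union> (UNIV - C)|lborel. f x) = (LINT x:C|lborel. f x) + (LINT x:UNIV - C|lborel. f x)"
      by (rule set_integral_Un[OF Diff_disjoint set_int[OF C] set_int[OF D]])
    moreover have "(LINT x:C \<union> (UNIV - C)|lborel. f x) = 0"
      using all by (simp add: set_lebesgue_integral_def)
    ultimately show ?case using compl(2) by linarith
  next
    case (union C)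
    have C: "C i \<in> sets borel" for i using borel union(2) by blast
    have "(LINT x:(\<Union>i. C i)|lborel. f x) = (\<Sum>i. (LINT x:(C i)|lborel. f x))"
    proof (rule lebesgue_integral_countable_add)
      show "C i \<in> sets lborel" for i using C by simp
      show "C i \<inter> C j = {}" if "i \<noteq> j" for i j using union(1) that by (auto simp: disjoint_family_on_def)
      show "set_integrable lborel (\<Union>i. C i) f" using C by (intro set_int sets.countable_UN) auto
    qed
    then show ?case using union(3) by simp
  qed
qed

text \<open>The fundamental lemma of the calculus of variations. Box bumps as test functions show by
  dominated convergence that all box integrals vanish, and boxes determine an integrable function
  almost everywhere.\<close>

lemma locally_integrable_AE_eq_0:
  assumes g: "locally_integrable (g :: plane \<Rightarrow> real)"
    and test: "\<And>\<phi>. test_function \<phi> \<Longrightarrow> (LINT x|lebesgue. g x * \<phi> x) = 0"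
  shows "AE x in lebesgue. g x = 0"
proof -
  have meas: "g \<in> borel_measurable lebesgue" using g locally_integrable_measurable by blast
  have int: "integrable lebesgue (\<lambda>x. indicator (box a b) x *\<^sub>R g x)" for a b
    using g unfolding locally_integrable_def set_integrable_def[symmetric]
    by (meson box_subset_cbox compact_cbox lborelD borel_open open_box sets_completionI_sets set_integrable_subset)
  have box: "(LINT x:box a b|lebesgue. g x) = 0" for a b
  proof -
    have "(\<lambda>n. LINT x|lebesgue. g x * box_bump a b n x) \<longlonglongrightarrow> (LINT x|lebesgue. indicator (box a b) x *\<^sub>R g x)"
    proof (rule integral_dominated_convergence[where w="\<lambda>x. norm (indicator (box a b) x *\<^sub>R g x)"])
      show "integrable lebesgue (\<lambda>x. norm (indicator (box a b) x *\<^sub>R g x))"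
        using int by (rule integrable_norm)
      show "(\<lambda>x. indicator (box a b) x *\<^sub>R g x) \<in> borel_measurable lebesgue" using int by auto
      show "(\<lambda>x. g x * box_bump a b n x) \<in> borel_measurable lebesgue" for n
        by (intro borel_measurable_times meas continuous_lebesgue_measurable smooth_continuous
            test_function_smooth test_function_box_bump)
      show "AE x in lebesgue. (\<lambda>n. g x * box_bump a b n x) \<longlonglongrightarrow> indicator (box a b) x *\<^sub>R g x"
        by (auto intro!: AE_I2 tendsto_mult box_bump_tendsto simp: mult.commute[of "indicator _ _"])
      show "AE x in lebesgue. norm (g x * box_bump a b n x) \<le> norm (indicator (box a b) x *\<^sub>R g x)" for n
        using mult_left_mono[OF box_bump_bounds, of "\<bar>g _\<bar>"]
        by (auto intro!: AE_I2 simp: abs_mult mult.commute)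
    qed
    with test[OF test_function_box_bump] show ?thesis
      by (simp add: set_lebesgue_integral_def LIMSEQ_const_iff)
  qed
  \<comment> \<open>The pi-lambda argument runs over Borel sets, so \<open>g\<close> is replaced by
    a Borel function that agrees with it almost everywhere.\<close>
  obtain g' where g': "g' \<in> borel_measurable lborel" and eq: "AE x in lborel. g x = g' x"
    using completion_ex_borel_measurable_real[OF meas] by blast
  have eqc: "AE x in lebesgue. g x = g' x" using eq by (rule AE_completion)
  have [measurable]: "g' \<in> borel_measurable borel" using g' by simp
  have int': "integrable lborel (\<lambda>x. indicator (box a b) x *\<^sub>R g' x)" for a b
  proof -
    have "integrable lebesgue (\<lambda>x. indicator (box a b) x *\<^sub>R g' x)"
      by (rule integrable_cong_AE_imp[OF int[of a b]])
         (use eqc in \<open>auto intro!: measurable_completion elim!: eventually_mono\<close>)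
    then show ?thesis by (subst (asm) integrable_completion) auto
  qed
  have box': "(LINT x:box a b|lborel. g' x) = 0" for a b
  proof -
    have "(LINT x:box a b|lborel. g' x) = (LINT x|lebesgue. indicator (box a b) x *\<^sub>R g' x)"
      unfolding set_lebesgue_integral_def by (subst integral_completion) auto
    also have "\<dots> = (LINT x|lebesgue. indicator (box a b) x *\<^sub>R g x)"
      by (rule integral_cong_AE)
         (use eqc int in \<open>auto intro!: measurable_completion elim!: eventually_mono\<close>)
    finally show ?thesis using box by (simp add: set_lebesgue_integral_def)
  qed
  \<comment> \<open>\<open>g'\<close> need not be integrable on the whole plane. It is cut off to an
    exhausting sequence of boxes, and a box meets \<open>Q n\<close> in a box again.\<close>
  define Q :: "nat \<Rightarrow> plane set" where "Q n = box (\<chi> i. - real n) (\<chi> i. real n)" for n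
  have "AE x in lborel. indicator (Q n) x *\<^sub>R g' x = 0" for n
  proof (rule AE_eq_0_if_box_integrals_eq_0)
    show "integrable lborel (\<lambda>x. indicator (Q n) x *\<^sub>R g' x)" using int' by (simp add: Q_def)
    show "(LINT x|lborel. indicator (Q n) x *\<^sub>R g' x) = 0"
      using box' by (simp add: Q_def set_lebesgue_integral_def)
    fix a b :: plane
    obtain c d where cd: "box a b \<inter> Q n = box c d" unfolding Q_def box_Int_box by blast
    have "(LINT x:box a b|lborel. indicator (Q n) x *\<^sub>R g' x) = (LINT x:box c d|lborel. g' x)"
      unfolding set_lebesgue_integral_def cd[symmetric]
      by (intro Bochner_Integration.integral_cong) (auto simp: indicator_def)
    then show "(LINT x:box a b|lborel. indicator (Q n) x *\<^sub>R g' x) = 0" using box' by simp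
  qed
  then have "AE x in lborel. \<forall>n. indicator (Q n) x *\<^sub>R g' x = 0" by (subst AE_all_countable) blast
  then have "AE x in lborel. g' x = 0"
  proof (rule eventually_mono)
    fix x assume *: "\<forall>n. indicator (Q n) x *\<^sub>R g' x = 0"
    obtain n where "\<bar>x $ 1\<bar> + \<bar>x $ 2\<bar> < real n" using reals_Archimedean2 by blast
    then have "x \<in> Q n" by (auto simp: Q_def mem_box_cart forall_2)
    with * show "g' x = 0" by (auto dest: spec[of _ n])
  qed
  then have "AE x in lebesgue. g' x = 0" by (rule AE_completion)
  with eqc show ?thesis by eventually_elim simp
qed

lemma locally_integrable_component:
  assumes "locally_integrable (G :: plane \<Rightarrow> plane)"
  shows "locally_integrable (\<lambda>x. G x $ i)"
  unfolding locally_integrable_def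
proof (intro allI impI)
  fix K :: "plane set" assume "compact K"
  then have "set_integrable lebesgue K G" using assms by (simp add: locally_integrable_def)
  then have "integrable lebesgue (\<lambda>x. (indicator K x *\<^sub>R G x) \<bullet> axis i 1)"
    unfolding set_integrable_def by (rule integrable_inner_left[rotated])
  then show "set_integrable lebesgue K (\<lambda>x. G x $ i)"
    by (simp add: set_integrable_def inner_axis)
qed

lemma locally_integrable_diff:
  "locally_integrable f \<Longrightarrow> locally_integrable g \<Longrightarrow> locally_integrable (\<lambda>x. f x - g x)"
  by (auto simp: locally_integrable_def)

lemma integrable_times_test:
  assumes "locally_integrable (f :: plane \<Rightarrow> real)" "test_function \<phi>"
  shows "integrable lebesgue (\<lambda>x. f x * \<phi> x)" "integrable lebesgue (\<lambda>x. f x * partial i \<phi> x)"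
proof -
  obtain S where S: "compact S" "\<And>x. x \<notin> S \<Longrightarrow> \<phi> x = 0"
    using test_function_bounded_support[OF assms(2)] by metis
  have sm: "smooth \<phi>" using assms(2) test_function_smooth by blast
  have d\<phi>: "partial i \<phi> x = 0" if "x \<notin> S" for x
    by (rule partial_eq_0_outside[of S \<phi> x i, OF compact_imp_closed[OF S(1)] S(2) that])
  show "integrable lebesgue (\<lambda>x. f x * \<phi> x)"
    by (rule integrable_locally_integrable_mult[of _ _ S]) (use assms sm S in \<open>auto intro: smooth_continuous\<close>)
  show "integrable lebesgue (\<lambda>x. f x * partial i \<phi> x)"
    by (rule integrable_locally_integrable_mult[of _ _ S]) 
      (use assms sm S d\<phi> in \<open>auto intro: smooth_continuous smooth_partial\<close>)
qed

lemma has_weak_gradient_diff: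
  assumes "has_weak_gradient f F" "has_weak_gradient g G"
  shows "has_weak_gradient (\<lambda>x. f x - g x) (\<lambda>x. F x - G x)"
  using assms unfolding has_weak_gradient_def
  by (auto simp: locally_integrable_diff locally_integrable_component integrable_times_test left_diff_distrib)

lemma has_weak_gradient_unique:
  assumes "has_weak_gradient f F" "has_weak_gradient f G"
  shows "AE x in lebesgue. F x = G x"
proof -
  have "AE x in lebesgue. F x $ i - G x $ i = 0" for i
  proof (rule locally_integrable_AE_eq_0)
    have F: "locally_integrable (\<lambda>x. F x $ i)" and G: "locally_integrable (\<lambda>x. G x $ i)"
      using assms by (auto simp: has_weak_gradient_def locally_integrable_component)
    then show "locally_integrable (\<lambda>x. F x $ i - G x $ i)" by (rule locally_integrable_diff)
    fix \<phi> :: "plane \<Rightarrow> real" assume "test_function \<phi>"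
    then show "(LINT x|lebesgue. (F x $ i - G x $ i) * \<phi> x) = 0"
      using assms F G integrable_times_test
      by (simp add: has_weak_gradient_def left_diff_distrib)
  qed
  then have "AE x in lebesgue. \<forall>i. F x $ i - G x $ i = 0" by (simp add: AE_all_countable)
  then show ?thesis by eventually_elim (simp add: vec_eq_iff)
qed

section \<open>Translates and periodicity of weak gradients\<close>

lemma locally_integrable_translation:
  assumes "locally_integrable f"
  shows "locally_integrable (\<lambda>x. f (x + v))"
  unfolding locally_integrable_def
proof (intro allI impI)
  fix K :: "plane set" assume "compact K"
  then have "compact ((+) v ` K)" by (rule compact_translation)
  then have "integrable lebesgue (\<lambda>x. indicator ((+) v ` K) x *\<^sub>R f x)"
    using assms by (auto simp: locally_integrable_def set_integrable_def)
  then have "integrable lebesgue (\<lambda>x. indicator ((+) v ` K) (x + v) *\<^sub>R f (x + v))"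
    using integrable_translation borel_measurable_integrable by blast
  moreover have "indicat_real ((+) v ` K) (x + v) = indicator K x" for x
    by (auto simp: indicator_def add.commute)
  ultimately show "set_integrable lebesgue K (\<lambda>x. f (x + v))" by (simp add: set_integrable_def)
qed

lemma partial_translation:
  assumes "f differentiable (at (x + v))"
  shows "partial i (\<lambda>x. f (x + v)) x = partial i f (x + v)"
proof -
  obtain D where D: "(f has_derivative D) (at (x + v))" using assms differentiable_def by blast
  have "((\<lambda>x. f (x + v)) has_derivative D) (at x)"
    by (rule has_derivative_compose[of "\<lambda>x. x + v" "\<lambda>h. h", OF _ D]) (auto intro!: derivative_eq_intros)
  then show ?thesis using D by (simp add: partial_eq)
qed

lemma Ck_translation: "Ck n f \<Longrightarrow> Ck n (\<lambda>x. f (x + v))"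
proof (induction n arbitrary: f)
  case 0
  then have "continuous_on UNIV f" by simp
  then show ?case by (auto intro!: continuous_on_compose2[of UNIV f] continuous_intros)
next
  case (Suc n)
  then have d: "f differentiable (at y)" and "Ck n (partial i f)" for y i by auto
  then have "partial i (\<lambda>x. f (x + v)) = (\<lambda>x. partial i f (x + v))" for i
    by (auto simp: partial_translation)
  moreover have "(\<lambda>x. f (x + v)) differentiable (at x)" for x
    by (rule differentiable_compose[OF d]) auto
  ultimately show ?case using Suc by auto
qed

lemma test_function_translation:
  assumes "test_function f" shows "test_function (\<lambda>x. f (x + v))"
proof -
  obtain S where S: "compact S" "\<And>x. x \<notin> S \<Longrightarrow> f x = 0"
    using test_function_bounded_support[OF assms] by metis
  show ?thesis
  proof (rule test_functionI[of _ "(+) (- v) ` S"])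
    show "smooth (\<lambda>x. f (x + v))"
      using test_function_smooth[OF assms] by (auto simp: smooth_def Ck_translation)
    show "bounded ((+) (- v) ` S)" by (rule bounded_translation[OF compact_imp_bounded[OF S(1)]])
    show "f (x + v) = 0" if "x \<notin> (+) (- v) ` S" for x
      using that by (intro S(2)) (auto simp: image_iff)
  qed
qed

lemma has_weak_gradient_translation:
  assumes "has_weak_gradient f G"
  shows "has_weak_gradient (\<lambda>x. f (x + v)) (\<lambda>x. G (x + v))"
  unfolding has_weak_gradient_def
proof (intro conjI allI impI)
  show "locally_integrable (\<lambda>x. f (x + v))" "locally_integrable (\<lambda>x. G (x + v))"
    using assms by (auto simp: has_weak_gradient_def locally_integrable_translation)
  fix \<phi> :: "plane \<Rightarrow> real" and i assume \<phi>: "test_function \<phi>"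
  \<comment> \<open>Moving the test function by \<open>- v\<close> is equivalent to moving
    \<open>f\<close> and \<open>G\<close> by \<open>v\<close>, by translation invariance of the
    integral.\<close>
  define \<psi> where "\<psi> x = \<phi> (x - v)" for x
  have \<psi>: "test_function \<psi>" using test_function_translation[OF \<phi>, of "- v"] by (simp add: \<psi>_def[abs_def])
  have d: "partial i \<phi> x = partial i \<psi> (x + v)" for x
    using partial_translation[of \<phi> "x + v" "- v" i] test_function_smooth[OF \<phi>]
    by (simp add: \<psi>_def[abs_def] smooth_differentiable)
  have f: "locally_integrable f" "locally_integrable (\<lambda>x. G x $ i)"
    using assms by (auto simp: has_weak_gradient_def locally_integrable_component)
  have "(LINT x|lebesgue. f (x + v) * partial i \<phi> x) = (LINT x|lebesgue. f x * partial i \<psi> x)"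
    unfolding d by (rule integral_translation[of "\<lambda>x. f x * partial i \<psi> x"])
      (use integrable_times_test[OF f(1) \<psi>] in auto)
  moreover have "(LINT x|lebesgue. G (x + v) $ i * \<phi> x) = (LINT x|lebesgue. G x $ i * \<psi> x)"
    using integral_translation[of "\<lambda>x. G x $ i * \<psi> x" v] integrable_times_test[OF f(2) \<psi>]
    by (auto simp: \<psi>_def)
  ultimately show "(LINT x|lebesgue. f (x + v) * partial i \<phi> x) = - (LINT x|lebesgue. G (x + v) $ i * \<phi> x)"
    using assms \<psi> by (simp add: has_weak_gradient_def)
qed

lemma has_weak_gradient_cong_AE:
  assumes "has_weak_gradient f G" "AE x in lebesgue. f x = g x" "locally_integrable g"
  shows "has_weak_gradient g G"
  unfolding has_weak_gradient_def
proof (intro conjI allI impI)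
  fix \<phi> :: "plane \<Rightarrow> real" and i assume \<phi>: "test_function \<phi>"
  have "(LINT x|lebesgue. g x * partial i \<phi> x) = (LINT x|lebesgue. f x * partial i \<phi> x)"
    by (rule integral_cong_AE)
      (use assms \<phi> in \<open>auto simp: has_weak_gradient_def integrable_times_test intro!: borel_measurable_integrable elim!: eventually_mono\<close>)
  with assms(1) \<phi> show "(LINT x|lebesgue. g x * partial i \<phi> x) = - (LINT x|lebesgue. G x $ i * \<phi> x)"
    by (simp add: has_weak_gradient_def)
qed (use assms in \<open>auto simp: has_weak_gradient_def\<close>)

text \<open>The translate of \<open>G\<close> is a weak gradient of the translate of
  \<open>f\<close>, which is \<open>f\<close> almost everywhere; uniqueness then identifies it with
  \<open>G\<close>.\<close>

lemma weak_gradient_periodic: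
  assumes "has_weak_gradient f G" "AE x in lebesgue. f (x + v) = f x"
  shows "AE x in lebesgue. G (x + v) = G x"
proof (rule has_weak_gradient_unique)
  show "has_weak_gradient f (\<lambda>x. G (x + v))"
    by (rule has_weak_gradient_cong_AE[OF has_weak_gradient_translation[OF assms(1)] assms(2)])
       (use assms(1) in \<open>auto simp: has_weak_gradient_def\<close>)
qed fact

subsection \<open>Periodic integration by parts\<close>

lemma axis_component: "axis i c $ j = (if j = i then c else 0)"
  by (simp add: axis_def)

lemma partial_cong_open:
  assumes "open S" "x \<in> S" "\<And>y. y \<in> S \<Longrightarrow> f y = g y" "g differentiable (at x)"
  shows "partial i f x = partial i g x"
proof -
  obtain D where D: "(g has_derivative D) (at x)" using assms(4) differentiable_def by blast
  have "(f has_derivative D) (at x)"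
    by (rule has_derivative_transform_within_open[OF D]) (use assms in auto)
  then show ?thesis using D by (simp add: partial_eq)
qed

text \<open>The half of the strip with coordinate in [L, 2L) is moved onto [0, L) by one
  translation. This is the folding step for a single coordinate.\<close>

lemma integral_fold_strip:
  fixes f :: "plane \<Rightarrow> real"
  assumes f: "integrable lebesgue f" and L: "L > 0"
    and supp: "\<And>x. f x \<noteq> 0 \<Longrightarrow> 0 \<le> x $ i \<and> x $ i < 2 * L"
  shows "(LINT x|lebesgue. f x) =
    (LINT x|lebesgue. indicator {x. 0 \<le> x $ i \<and> x $ i < L} x * (f x + f (x + axis i L)))"
proof -
  define A where "A = {x :: plane. 0 \<le> x $ i \<and> x $ i < L}"
  define A' where "A' = {x :: plane. L \<le> x $ i \<and> x $ i < 2 * L}"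
  have sets: "A \<in> sets borel" "A' \<in> sets borel" unfolding A_def A'_def by measurable
  have int: "integrable lebesgue (\<lambda>x. indicator C x * f x)" if "C \<in> sets borel" for C
    using integrable_mult_indicator[of C lebesgue f] that f by simp
  have intT: "integrable lebesgue (\<lambda>x. indicator A' (x + axis i L) * f (x + axis i L))"
    using integrable_translation[of "\<lambda>x. indicator A' x * f x" "axis i L"] int[OF sets(2)] by auto
  have ind: "indicat_real A' (x + axis i L) = indicator A x" for x
    by (simp add: indicator_def A_def A'_def axis_component)
  have "f x = indicator A x * f x + indicator A' x * f x" for x
    using supp[of x] L by (cases "f x = 0") (auto simp: indicator_def A_def A'_def)
  then have "(LINT x|lebesgue. f x) = (LINT x|lebesgue. indicator A x * f x + indicator A' x * f x)"
    by presburger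
  also have "\<dots> = (LINT x|lebesgue. indicator A x * f x) + (LINT x|lebesgue. indicator A' x * f x)"
    by (intro Bochner_Integration.integral_add int sets)
  also have "(LINT x|lebesgue. indicator A' x * f x) =
      (LINT x|lebesgue. indicator A' (x + axis i L) * f (x + axis i L))"
    by (rule integral_translation[symmetric]) (use int[OF sets(2)] in auto)
  also have "(LINT x|lebesgue. indicator A x * f x) + \<dots> =
      (LINT x|lebesgue. indicator A x * f x + indicator A' (x + axis i L) * f (x + axis i L))"
    by (intro Bochner_Integration.integral_add[symmetric] int sets intT)
  finally show ?thesis unfolding ind A_def[symmetric] by (simp add: distrib_left)
qed

text \<open>The periodization of \<open>\<zeta>\<close>, reduced to the four lattice shifts that can
  carry a point of [0, L)^2 into a support contained in [0, 2L)^2.\<close>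

definition cell_shifts_sum :: "real \<Rightarrow> (plane \<Rightarrow> real) \<Rightarrow> plane \<Rightarrow> real" where
  "cell_shifts_sum L \<zeta> x = \<zeta> x + \<zeta> (x + axis 1 L) + (\<zeta> (x + axis 2 L) + \<zeta> (x + axis 1 L + axis 2 L))"

text \<open>Folding produces half-open squares while \<open>cell\<close> is closed; they agree off
  the boundary, which is a null set.\<close>

lemma AE_interior_cell: "AE x in lebesgue. x \<in> cell L \<longrightarrow> x \<in> box 0 (\<chi> i. L)"
proof -
  have "negligible (cell L - box 0 (\<chi> i. L))"
    unfolding cell_def by (rule negligible_frontier_interval)
  then have "cell L - box 0 (\<chi> i. L) \<in> null_sets lebesgue"
    by (simp add: negligible_iff_null_sets)
  then show ?thesis by (rule AE_I') auto
qed

text \<open>Connects integrals over the plane, where weak gradients are defined, with integrals over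
  a cell. Each coordinate is folded once, and periodicity lets \<open>F\<close> be factored out of
  the two summands that a fold creates.\<close>

lemma integral_periodic_mult:
  fixes F :: "plane \<Rightarrow> real"
  assumes L: "L > 0" and F: "locally_integrable F" and per: "\<And>i. AE x in lebesgue. F (x + axis i L) = F x"
    and \<zeta>: "continuous_on UNIV \<zeta>" "compact K" "\<And>x. x \<notin> K \<Longrightarrow> \<zeta> x = 0"
    and K: "\<And>x i. x \<in> K \<Longrightarrow> 0 \<le> x $ i \<and> x $ i < 2 * L"
  shows "(LINT x|lebesgue. F x * \<zeta> x) = (LINT x:cell L|lebesgue. F x * cell_shifts_sum L \<zeta> x)"
proof -
  define A where "A i = {x :: plane. 0 \<le> x $ i \<and> x $ i < L}" for i
  define \<zeta>2 where "\<zeta>2 x = \<zeta> x + \<zeta> (x + axis 1 L)" for x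
  define f2 where "f2 x = indicator (A 1) x * (F x * \<zeta>2 x)" for x
  have measA: "A i \<in> sets borel" for i unfolding A_def by measurable
  have supp: "\<zeta> x \<noteq> 0 \<Longrightarrow> 0 \<le> x $ i \<and> x $ i < 2 * L" for x i using \<zeta>(3) K by blast
  have int: "integrable lebesgue (\<lambda>x. F x * \<zeta> x)"
    using integrable_locally_integrable_mult[OF F \<zeta>] .
  have cont2: "continuous_on UNIV \<zeta>2"
    unfolding \<zeta>2_def by (intro continuous_intros \<zeta>(1) continuous_on_compose2[OF \<zeta>(1)]) auto
  have int2': "integrable lebesgue (\<lambda>x. F x * \<zeta>2 x)"
  proof (rule integrable_locally_integrable_mult[OF F cont2])
    show "compact (K \<union> (\<lambda>x. - axis 1 L + x) ` K)" using \<zeta>(2) by (intro compact_Un compact_translation)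
    show "\<zeta>2 x = 0" if "x \<notin> K \<union> (\<lambda>x. - axis 1 L + x) ` K" for x
    proof -
      have "x + axis 1 L \<notin> K" using that by (metis UnI2 add.commute add_uminus_conv_diff add_diff_cancel_right' image_eqI)
      with that show ?thesis using \<zeta>(3) by (auto simp: \<zeta>2_def)
    qed
  qed
  have int2: "integrable lebesgue f2"
    using integrable_mult_indicator[of "A 1" lebesgue "\<lambda>x. F x * \<zeta>2 x"] measA int2'
    by (simp add: f2_def[abs_def])
  have "(LINT x|lebesgue. F x * \<zeta> x) =
      (LINT x|lebesgue. indicator (A 1) x * (F x * \<zeta> x + F (x + axis 1 L) * \<zeta> (x + axis 1 L)))"
    unfolding A_def by (rule integral_fold_strip[OF int L]) (use supp in auto)
  also have "\<dots> = (LINT x|lebesgue. f2 x)"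
  proof (rule integral_cong_AE)
    show "(\<lambda>x. indicator (A 1) x * (F x * \<zeta> x + F (x + axis 1 L) * \<zeta> (x + axis 1 L))) \<in> borel_measurable lebesgue"
      using measA locally_integrable_measurable[OF F] continuous_lebesgue_measurable[OF \<zeta>(1)]
      by (intro borel_measurable_times borel_measurable_add borel_measurable_indicator borel_measurable_translation) auto
    show "f2 \<in> borel_measurable lebesgue" using int2 by auto
    show "AE x in lebesgue. indicator (A 1) x * (F x * \<zeta> x + F (x + axis 1 L) * \<zeta> (x + axis 1 L)) = f2 x"
      using per[of 1] by eventually_elim (simp add: f2_def \<zeta>2_def distrib_left)
  qed
  \<comment> \<open>The second fold acts on \<open>f2\<close>, already confined to the strip
    \<open>A 1\<close>, which is invariant under shifts along the second axis.\<close>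
  also have "\<dots> = (LINT x|lebesgue. indicator (A 2) x * (f2 x + f2 (x + axis 2 L)))"
    unfolding A_def
  proof (rule integral_fold_strip[OF int2 L])
    fix x assume "f2 x \<noteq> 0"
    then have "\<zeta> x \<noteq> 0 \<or> \<zeta> (x + axis 1 L) \<noteq> 0" by (auto simp: f2_def \<zeta>2_def)
    then show "0 \<le> x $ 2 \<and> x $ 2 < 2 * L"
      using supp[of x 2] supp[of "x + axis 1 L" 2] by (auto simp: axis_component)
  qed
  also have "\<dots> = (LINT x:cell L|lebesgue. F x * cell_shifts_sum L \<zeta> x)"
    unfolding set_lebesgue_integral_def
  proof (rule integral_cong_AE)
    show "(\<lambda>x. indicator (A 2) x * (f2 x + f2 (x + axis 2 L))) \<in> borel_measurable lebesgue"
      using measA int2 borel_measurable_translation[of f2 "axis 2 L"]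
      by (intro borel_measurable_times borel_measurable_add borel_measurable_indicator) auto
    have cont: "continuous_on UNIV (cell_shifts_sum L \<zeta>)"
      unfolding cell_shifts_sum_def[abs_def]
      by (intro continuous_intros \<zeta>(1) continuous_on_compose2[OF \<zeta>(1)]) auto
    show "(\<lambda>x. indicator (cell L) x *\<^sub>R (F x * cell_shifts_sum L \<zeta> x)) \<in> borel_measurable lebesgue"
      by (intro borel_measurable_scaleR borel_measurable_times borel_measurable_indicator
          continuous_lebesgue_measurable[OF cont] locally_integrable_measurable[OF F]) (auto simp: cell_def)
    show "AE x in lebesgue. indicator (A 2) x * (f2 x + f2 (x + axis 2 L)) =
        indicator (cell L) x *\<^sub>R (F x * cell_shifts_sum L \<zeta> x)"
      using per[of 2] AE_interior_cell[of L]
    proof eventually_elim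
      case (elim x)
      have "x \<in> cell L \<longleftrightarrow> x \<in> A 1 \<and> x \<in> A 2"
        using elim(2) by (auto simp: cell_def A_def mem_box_cart forall_2)
      moreover have "x + axis 2 L \<in> A 1 \<longleftrightarrow> x \<in> A 1" by (simp add: A_def axis_component)
      ultimately show ?case
        using elim(1) by (auto simp: f2_def \<zeta>2_def cell_shifts_sum_def indicator_def algebra_simps)
    qed
  qed
  finally show ?thesis .
qed

text \<open>
  Supported in \<open>[L/4, 7L/4]\<close>; the \<open>L\<close>-translates add up to \<open>1\<close> on a neighbourhood of \<open>[0, L]\<close>, so that
  the derivatives of the translates add up to \<open>0\<close> on all of \<open>[0, L]\<close>.
\<close>

definition unity_profile :: "real \<Rightarrow> real \<Rightarrow> real" where
  "unity_profile L t = smooth_step (2 * t / L - 1 / 2) - smooth_step (2 * t / L - 5 / 2)"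

lemma Ck_real_unity_profile: "Ck_real n (unity_profile L)"
proof -
  have "Ck_real n (\<lambda>t. smooth_step ((2 / L) * t + (- 1 / 2)) + (-1) * smooth_step ((2 / L) * t + (- 5 / 2)))"
    by (intro Ck_real_add Ck_real_mult Ck_real_const Ck_real_affine[of n smooth_step] Ck_real_smooth_step)
  then show ?thesis by (simp add: unity_profile_def[abs_def])
qed

lemma unity_profile_eq_0:
  assumes "L > 0" "t < L / 4 \<or> t > 7 / 4 * L"
  shows "unity_profile L t = 0"
  using assms(2)
proof
  assume "t < L / 4"
  then have "2 * t / L \<le> 1 / 2" using assms(1) by (simp add: field_simps)
  then show ?thesis by (simp add: unity_profile_def smooth_step_eq)
next
  assume "t > 7 / 4 * L"
  then have "2 * t / L \<ge> 7 / 2" using assms(1) by (simp add: field_simps)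
  then show ?thesis by (simp add: unity_profile_def smooth_step_eq)
qed

text \<open>In this range the falling step of the first term has not begun and the rising step of
  the second is complete. The two remaining steps are the same function with opposite signs, leaving
  1.\<close>

lemma unity_profile_sum:
  assumes "L > 0" "- L / 4 < t" "t < 5 / 4 * L"
  shows "unity_profile L t + unity_profile L (t + L) = 1"
proof -
  have "2 * t / L - 5 / 2 \<le> 0" "2 * (t + L) / L - 1 / 2 \<ge> 1"
    "2 * (t + L) / L - 5 / 2 = 2 * t / L - 1 / 2"
    using assms by (auto simp: field_simps)
  then show ?thesis by (simp add: unity_profile_def smooth_step_eq)
qed

lemma partial_cell_shifts_sum:
  assumes "smooth f"
  shows "partial i (cell_shifts_sum L f) x = cell_shifts_sum L (partial i f) x"
proof -
  have d: "(\<lambda>x. f (x + v)) differentiable (at x)" for v x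
    using assms Ck_translation smooth_differentiable smooth_def by blast
  have p: "partial i (\<lambda>x. f (x + v)) x = partial i f (x + v)" for v
    by (rule partial_translation) (use assms smooth_differentiable in blast)
  show ?thesis
    unfolding cell_shifts_sum_def[abs_def] add.assoc[of _ "axis _ _" "axis _ _"]
    using d[of 0] d p by (subst partial_add partial_add[OF _ differentiable_add] | (intro differentiable_add; simp; fail) | simp)+
qed

text \<open>Testing with \<open>w\<close> times a smooth partition of unity adapted to the period lattice.\<close>

lemma weak_gradient_periodic_by_parts:
  assumes L: "L > 0" and wg: "has_weak_gradient f G" and per: "cell_periodic L f"
    and w: "smooth w" "\<And>i x. w (x + axis i L) = w x"
  shows "(LINT x:cell L|lebesgue. G x $ i * w x) = - (LINT x:cell L|lebesgue. f x * partial i w x)"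
proof -
  define \<eta> where "\<eta> x = unity_profile L (x $ 1) * unity_profile L (x $ 2)" for x :: plane
  define \<phi> where "\<phi> x = w x * \<eta> x" for x
  define K :: "plane set" where "K = cbox (\<chi> i. L / 4) (\<chi> i. 7 / 4 * L)"
  have sm\<eta>: "smooth \<eta>"
    unfolding \<eta>_def using smooth_coord[OF Ck_real_unity_profile, of L 1 _ 0] by (intro smooth_mult) auto
  then have sm: "smooth \<phi>" unfolding \<phi>_def using w by (intro smooth_mult) auto
  have supp: "\<phi> x = 0" if "x \<notin> K" for x
    using that unity_profile_eq_0[OF L, of "x $ 1"] unity_profile_eq_0[OF L, of "x $ 2"]
    by (auto simp: \<phi>_def \<eta>_def K_def mem_box_cart forall_2 not_le)
  have supp': "partial i \<phi> x = 0" if "x \<notin> K" for x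
    by (rule partial_eq_0_outside[of K \<phi> x i, OF _ supp that]) (simp_all add: K_def closed_cbox)
  have test: "test_function \<phi>" by (rule test_functionI[of \<phi> K, OF sm _ supp]) (simp_all add: K_def)
  have K: "compact K" by (simp add: K_def)
  have K': "0 \<le> x $ i \<and> x $ i < 2 * L" if "x \<in> K" for x i
  proof -
    have "L / 4 \<le> x $ i" "x $ i \<le> 7 / 4 * L" using that by (simp_all add: K_def mem_box_cart)
    with L show ?thesis by linarith
  qed
  have sum: "cell_shifts_sum L \<phi> x = w x" if "x \<in> box (\<chi> i. - L / 4) (\<chi> i. 5 / 4 * L)" for x
  proof -
    have u: "unity_profile L (x $ i) + unity_profile L (x $ i + L) = 1" for i
      using that unity_profile_sum[OF L, of "x $ i"] by (auto simp: mem_box_cart)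
    have "cell_shifts_sum L \<phi> x = w x * ((unity_profile L (x $ 1) + unity_profile L (x $ 1 + L)) *
       (unity_profile L (x $ 2) + unity_profile L (x $ 2 + L)))"
      using w(2)[of _ 1] w(2)[of _ 2]
      by (simp add: cell_shifts_sum_def \<phi>_def \<eta>_def axis_component distrib_left distrib_right mult_ac)
    then show ?thesis by (simp only: u)
  qed
  have sub: "cell L \<subseteq> box (\<chi> i. - L / 4) (\<chi> i. 5 / 4 * L)"
  proof
    fix x assume "x \<in> cell L"
    then have x: "0 \<le> x $ j \<and> x $ j \<le> L" for j by (simp add: cell_def mem_box_cart)
    have "- L / 4 < x $ j \<and> x $ j < 5 / 4 * L" for j using L x[of j] by auto
    then show "x \<in> box (\<chi> i. - L / 4) (\<chi> i. 5 / 4 * L)" by (simp add: mem_box_cart)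
  qed
  have sum': "cell_shifts_sum L (partial i \<phi>) x = partial i w x" if "x \<in> cell L" for x
    unfolding partial_cell_shifts_sum[OF sm, symmetric]
    by (rule partial_cong_open[OF open_box _ sum]) (use that sub w smooth_differentiable in auto)
  have G: "locally_integrable (\<lambda>x. G x $ i)" "locally_integrable f"
    using wg by (auto simp: has_weak_gradient_def locally_integrable_component)
  have perG: "AE x in lebesgue. G (x + axis j L) $ i = G x $ i" for j
    using weak_gradient_periodic[OF wg, of "axis j L"] per
    by (auto simp: cell_periodic_def elim!: eventually_mono)
  \<comment> \<open>The shifts of \<open>\<phi>\<close> add up to \<open>w\<close> on the cell, and
    those of its derivative to the derivative of \<open>w\<close>. Both cell integrals thus unfold
    to the plane, where \<open>\<phi>\<close> is an admissible test function although
    \<open>w\<close> is not compactly supported in general.\<close>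
  have "(LINT x:cell L|lebesgue. G x $ i * w x) = (LINT x:cell L|lebesgue. G x $ i * cell_shifts_sum L \<phi> x)"
    using sub by (intro set_lebesgue_integral_cong) (auto simp: sum cell_def)
  also have "\<dots> = (LINT x|lebesgue. G x $ i * \<phi> x)"
    by (rule integral_periodic_mult[OF L G(1) perG, symmetric, of \<phi> K])
       (use sm K K' supp smooth_continuous in auto)
  also have "\<dots> = - (LINT x|lebesgue. f x * partial i \<phi> x)"
    using wg test by (simp add: has_weak_gradient_def)
  also have "(LINT x|lebesgue. f x * partial i \<phi> x) = (LINT x:cell L|lebesgue. f x * cell_shifts_sum L (partial i \<phi>) x)"
    by (rule integral_periodic_mult[OF L G(2), of "partial i \<phi>" K])
       (use sm K K' supp' per smooth_continuous smooth_partial in \<open>auto simp: cell_periodic_def\<close>)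
  also have "\<dots> = (LINT x:cell L|lebesgue. f x * partial i w x)"
    by (intro set_lebesgue_integral_cong) (auto simp: sum' cell_def[symmetric], simp add: cell_def)
  finally show ?thesis .
qed

subsection \<open>Fourier coefficients\<close>

text \<open>Expands the nonnegative integral of |g - T|^2, where \<open>T\<close> is the projection
  of \<open>g\<close> onto an orthogonal family of common squared norm \<open>c\<close>.
  Coefficients pair \<open>g\<close> with \<open>e k\<close> unconjugated, as
  \<open>fourier_coeff\<close> does with its exponential, so \<open>T\<close> runs along the
  conjugates.\<close>

lemma bessel_inequality:
  fixes g :: "'a \<Rightarrow> real" and e :: "'k \<Rightarrow> 'a \<Rightarrow> complex"
  assumes F: "finite F" and c: "c > 0"
    and g2: "integrable M (\<lambda>x. (g x)\<^sup>2)"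
    and ge: "\<And>k. k \<in> F \<Longrightarrow> integrable M (\<lambda>x. of_real (g x) * e k x)"
    and ee: "\<And>k l. k \<in> F \<Longrightarrow> l \<in> F \<Longrightarrow>
      has_bochner_integral M (\<lambda>x. e k x * cnj (e l x)) (if k = l then of_real c else 0)"
  shows "(\<Sum>k\<in>F. (cmod (LINT x|M. of_real (g x) * e k x))\<^sup>2) \<le> c * (LINT x|M. (g x)\<^sup>2)"
proof -
  define a where "a k = (LINT x|M. of_real (g x) * e k x)" for k
  define T where "T x = (\<Sum>k\<in>F. a k / c * cnj (e k x))" for x
  define Q where "Q = (\<Sum>k\<in>F. (cmod (a k))\<^sup>2)"
  define I where "I = (LINT x|M. (g x)\<^sup>2)"
  have expand: "complex_of_real ((cmod (g x - T x))\<^sup>2) =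
      of_real ((g x)\<^sup>2) - (\<Sum>k\<in>F. cnj (a k) / c * (g x * e k x)) - (\<Sum>k\<in>F. a k / c * cnj (g x * e k x))
      + (\<Sum>l\<in>F. \<Sum>k\<in>F. (a l / c * (cnj (a k) / c)) * (e k x * cnj (e l x)))" for x
  proof -
    have cT: "cnj (T x) = (\<Sum>k\<in>F. cnj (a k) / c * e k x)"
      by (simp add: T_def)
    have "complex_of_real ((cmod (g x - T x))\<^sup>2) = (g x - T x) * (g x - cnj (T x))"
      by (simp only: complex_norm_square complex_cnj_diff complex_cnj_complex_of_real)
    also have "\<dots> = of_real ((g x)\<^sup>2) - g x * cnj (T x) - g x * T x + T x * cnj (T x)"
      by (simp add: algebra_simps power2_eq_square)
    also have "g x * cnj (T x) = (\<Sum>k\<in>F. cnj (a k) / c * (g x * e k x))"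
      by (simp add: cT sum_distrib_left mult_ac)
    also have "g x * T x = (\<Sum>k\<in>F. a k / c * cnj (g x * e k x))"
      by (simp add: T_def sum_distrib_left mult_ac)
    also have "T x * cnj (T x) = (\<Sum>l\<in>F. \<Sum>k\<in>F. (a l / c * (cnj (a k) / c)) * (e k x * cnj (e l x)))"
      unfolding cT by (simp add: T_def sum_product mult_ac)
    finally show ?thesis .
  qed
  have hb_ge: "has_bochner_integral M (\<lambda>x. g x * e k x) (a k)" if "k \<in> F" for k
    using ge[OF that] by (simp add: a_def has_bochner_integral_integrable)
  have "has_bochner_integral M (\<lambda>x. complex_of_real ((g x)\<^sup>2)) (of_real I)"
    unfolding I_def by (intro has_bochner_integral_of_real has_bochner_integral_integrable g2)
  moreover have "has_bochner_integral M (\<lambda>x. \<Sum>k\<in>F. cnj (a k) / c * (g x * e k x)) (\<Sum>k\<in>F. cnj (a k) / c * a k)"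
    by (intro has_bochner_integral_sum has_bochner_integral_mult_right hb_ge)
  moreover have "has_bochner_integral M (\<lambda>x. \<Sum>k\<in>F. a k / c * cnj (g x * e k x)) (\<Sum>k\<in>F. a k / c * cnj (a k))"
    by (intro has_bochner_integral_sum has_bochner_integral_mult_right
        has_bochner_integral_bounded_linear[OF bounded_linear_cnj] hb_ge)
  moreover have "has_bochner_integral M (\<lambda>x. \<Sum>l\<in>F. \<Sum>k\<in>F. (a l / c * (cnj (a k) / c)) * (e k x * cnj (e l x)))
      (\<Sum>l\<in>F. \<Sum>k\<in>F. (a l / c * (cnj (a k) / c)) * (if k = l then of_real c else 0))"
    by (intro has_bochner_integral_sum has_bochner_integral_mult_right ee)
  ultimately have hb: "has_bochner_integral M (\<lambda>x. complex_of_real ((cmod (g x - T x))\<^sup>2))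
      (of_real I - (\<Sum>k\<in>F. cnj (a k) / c * a k) - (\<Sum>k\<in>F. a k / c * cnj (a k)) +
       (\<Sum>l\<in>F. \<Sum>k\<in>F. (a l / c * (cnj (a k) / c)) * (if k = l then of_real c else 0)))"
    unfolding expand by (intro has_bochner_integral_add has_bochner_integral_diff)
  \<comment> \<open>Orthogonality leaves only the diagonal. This sum and both cross terms equal Q/c,
    so the integral is I - Q/c - Q/c + Q/c.\<close>
  have "(\<Sum>l\<in>F. \<Sum>k\<in>F. (a l / c * (cnj (a k) / c)) * (if k = l then of_real c else 0)) = (\<Sum>l\<in>F. a l / c * cnj (a l))"
    using F c by (simp add: if_distrib[where f="\<lambda>z. _ * z"] cong: if_cong)
  moreover have "(\<Sum>k\<in>F. cnj (a k) / c * a k) = of_real (Q / c)"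
    by (simp add: Q_def complex_norm_square sum_divide_distrib mult_ac del: of_real_power)
  moreover have "(\<Sum>k\<in>F. a k / c * cnj (a k)) = of_real (Q / c)"
    by (simp add: Q_def complex_norm_square sum_divide_distrib mult_ac del: of_real_power)
  ultimately have "has_bochner_integral M (\<lambda>x. complex_of_real ((cmod (g x - T x))\<^sup>2)) (of_real (I - Q / c))"
    using hb by simp
  then have "has_bochner_integral M (\<lambda>x. Re (complex_of_real ((cmod (g x - T x))\<^sup>2))) (Re (of_real (I - Q / c)))"
    by (rule has_bochner_integral_bounded_linear[OF bounded_linear_Re])
  then have "has_bochner_integral M (\<lambda>x. (cmod (g x - T x))\<^sup>2) (I - Q / c)" by (simp del: of_real_power)
  then have "I - Q / c = (LINT x|M. (cmod (g x - T x))\<^sup>2)" by (simp add: has_bochner_integral_integral_eq)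
  then have "0 \<le> I - Q / c" by simp
  then show ?thesis using c by (simp add: Q_def a_def I_def field_simps)
qed

section \<open>Plane waves on the cell\<close>

definition wave :: "real \<Rightarrow> int ^ 2 \<Rightarrow> plane \<Rightarrow> complex" where
  "wave L k x = exp (- (2 * pi * \<i> * (wave_vector k \<bullet> x) / L))"

lemma wave_altdef: "wave L k x = cis (- (2 * pi * (wave_vector k \<bullet> x) / L))"
  by (simp add: wave_def cis_conv_exp mult_ac)

lemma wave_eq: "wave L k x = Complex (cos (((2 * pi / L) *\<^sub>R wave_vector k) \<bullet> x)) (- sin (((2 * pi / L) *\<^sub>R wave_vector k) \<bullet> x))"
  by (simp add: wave_altdef cis.ctr)

lemma norm_wave [simp]: "cmod (wave L k x) = 1"
  by (simp add: wave_altdef)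

lemma wave_mult_cnj: "wave L k x * cnj (wave L l x) = wave L (k - l) x"
  unfolding wave_altdef cis_cnj cis_mult
  by (rule arg_cong[of _ _ cis])
     (simp add: wave_vector_def inner_vec_def sum_2 add_divide_distrib diff_divide_distrib algebra_simps)

lemma wave_0 [simp]: "wave L 0 x = 1"
  by (simp add: wave_altdef wave_vector_def inner_vec_def)

lemma continuous_wave: "continuous_on S (wave L k)"
  unfolding wave_altdef[abs_def] divide_inverse by (intro continuous_intros)

lemma fourier_coeff_wave:
  "fourier_coeff L f k = (LINT x:cell L|lebesgue. of_real (f x) * wave L k x) / L\<^sup>2"
  by (simp add: fourier_coeff_def wave_def)

lemma cell_simps [simp]: "cell L \<in> sets lebesgue" "compact (cell L)" "cell L \<in> sets borel"
  by (auto simp: cell_def)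

lemma measure_cell: "L > 0 \<Longrightarrow> measure lebesgue (cell L) = L\<^sup>2"
  unfolding cell_def
  by (subst measure_completion)
     (auto simp: content_cbox_if_cart interval_eq_empty_cart prod_2 power2_eq_square)

lemma set_integrable_mult_wave:
  assumes "set_integrable lebesgue (cell L) f"
  shows "set_integrable lebesgue (cell L) (\<lambda>x. complex_of_real (f x) * wave L k x)"
  unfolding set_integrable_def
proof (rule Bochner_Integration.integrable_bound)
  show i: "integrable lebesgue (\<lambda>x. indicator (cell L) x *\<^sub>R f x)" using assms by (simp add: set_integrable_def)
  have eq: "(\<lambda>x. indicator (cell L) x *\<^sub>R (complex_of_real (f x) * wave L k x)) =
     (\<lambda>x. complex_of_real (indicator (cell L) x *\<^sub>R f x) * wave L k x)"
    by (auto simp: fun_eq_iff scaleR_conv_of_real)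
  show "(\<lambda>x. indicator (cell L) x *\<^sub>R (complex_of_real (f x) * wave L k x)) \<in> borel_measurable lebesgue"
    unfolding eq
    by (intro borel_measurable_times continuous_lebesgue_measurable[OF continuous_wave]
        measurable_compose[OF borel_measurable_integrable[OF i] borel_measurable_of_real])
qed (auto simp: norm_mult)

text \<open>The usual Fourier symbol of a derivative. Integration by parts over a period is stated
  for real weights, so it is applied to cosine and sine separately and the parts are
  recombined.\<close>

lemma fourier_coeff_weak_gradient:
  assumes L: "L > 0" and wg: "has_weak_gradient f G" and per: "cell_periodic L f"
  shows "fourier_coeff L (\<lambda>x. G x $ j) k = 2 * pi * \<i> * (wave_vector k $ j) / L * fourier_coeff L f k"
proof -
  define \<kappa> where "\<kappa> = (2 * pi / L) *\<^sub>R wave_vector k"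
  have f: "set_integrable lebesgue (cell L) f"
    using wg by (auto simp: has_weak_gradient_def locally_integrable_def)
  have G: "set_integrable lebesgue (cell L) (\<lambda>x. G x $ j)"
    using wg locally_integrable_component[of G] by (auto simp: has_weak_gradient_def locally_integrable_def)
  have sm: "smooth (\<lambda>x. sin (\<kappa> \<bullet> x))" "smooth (\<lambda>x. cos (\<kappa> \<bullet> x))"
    using smooth_ridge[of sin \<kappa> 0] smooth_ridge[of cos \<kappa> 0] Ck_real_sin_cos by auto
  \<comment> \<open>Integrality of \<open>k\<close> enters here: a lattice shift changes the phase
    by a multiple of 2 pi.\<close>
  have shift: "\<kappa> \<bullet> (x + axis i L) = \<kappa> \<bullet> x + 2 * pi * of_int (k $ i)" for x i
    using L by (simp add: \<kappa>_def inner_add_right inner_axis wave_vector_def)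
  have per_w: "sin (\<kappa> \<bullet> (x + axis i L)) = sin (\<kappa> \<bullet> x)" "cos (\<kappa> \<bullet> (x + axis i L)) = cos (\<kappa> \<bullet> x)" for x i
    unfolding shift sin_add cos_add sin_int_2pin cos_int_2pin by simp_all
  have dsin: "partial j (\<lambda>x. sin (\<kappa> \<bullet> x)) = (\<lambda>x. cos (\<kappa> \<bullet> x) * \<kappa> $ j)"
    using partial_ridge[of sin cos j \<kappa> 0] by (auto simp: fun_eq_iff)
  have dcos: "partial j (\<lambda>x. cos (\<kappa> \<bullet> x)) = (\<lambda>x. - sin (\<kappa> \<bullet> x) * \<kappa> $ j)"
    using partial_ridge[of cos "\<lambda>x. - sin x" j \<kappa> 0] by (auto simp: fun_eq_iff)
  have split: "(LINT x:cell L|lebesgue. of_real (h x) * wave L k x) =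
      Complex (LINT x:cell L|lebesgue. h x * cos (\<kappa> \<bullet> x)) (- (LINT x:cell L|lebesgue. h x * sin (\<kappa> \<bullet> x)))"
    if h: "set_integrable lebesgue (cell L) h" for h
  proof (rule complex_eqI)
    have i: "integrable lebesgue (\<lambda>x. indicator (cell L) x *\<^sub>R (complex_of_real (h x) * wave L k x))"
      using set_integrable_mult_wave[OF h] by (simp add: set_integrable_def)
    show "Re (LINT x:cell L|lebesgue. of_real (h x) * wave L k x) =
       Re (Complex (LINT x:cell L|lebesgue. h x * cos (\<kappa> \<bullet> x)) (- (LINT x:cell L|lebesgue. h x * sin (\<kappa> \<bullet> x))))"
      unfolding set_lebesgue_integral_def integral_Re[OF i, symmetric]
      by (simp add: wave_eq \<kappa>_def)
    show "Im (LINT x:cell L|lebesgue. of_real (h x) * wave L k x) =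
       Im (Complex (LINT x:cell L|lebesgue. h x * cos (\<kappa> \<bullet> x)) (- (LINT x:cell L|lebesgue. h x * sin (\<kappa> \<bullet> x))))"
      unfolding set_lebesgue_integral_def integral_Im[OF i, symmetric]
      by (simp add: wave_eq \<kappa>_def)
  qed
  have c: "(LINT x:cell L|lebesgue. G x $ j * cos (\<kappa> \<bullet> x)) = \<kappa> $ j * (LINT x:cell L|lebesgue. f x * sin (\<kappa> \<bullet> x))"
    using weak_gradient_periodic_by_parts[OF L wg per sm(2) per_w(2), of j]
    unfolding dcos by (simp add: set_lebesgue_integral_def mult_ac flip: integral_mult_right_zero)
  have s: "(LINT x:cell L|lebesgue. G x $ j * sin (\<kappa> \<bullet> x)) = - \<kappa> $ j * (LINT x:cell L|lebesgue. f x * cos (\<kappa> \<bullet> x))"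
    using weak_gradient_periodic_by_parts[OF L wg per sm(1) per_w(1), of j]
    unfolding dsin by (simp add: set_lebesgue_integral_def mult_ac flip: integral_mult_right_zero)
  have "(LINT x:cell L|lebesgue. of_real (G x $ j) * wave L k x) =
      \<i> * \<kappa> $ j * (LINT x:cell L|lebesgue. of_real (f x) * wave L k x)"
    unfolding split[OF f] split[OF G] c s by (simp add: complex_eq_iff)
  then show ?thesis
    unfolding fourier_coeff_wave by (simp add: \<kappa>_def mult_ac)
qed

text \<open>For \<open>k \<noteq> 0\<close> this follows from the symbol formula for the constant
  function 1: its weak gradient is 0, so a nonzero component of \<open>k\<close> times the
  coefficient is 0.\<close>

lemma set_integral_wave:
  assumes L: "L > 0"
  shows "(LINT x:cell L|lebesgue. wave L k x) = (if k = 0 then of_real (L\<^sup>2) else 0)"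
proof (cases "k = 0")
  case True
  then show ?thesis
    using measure_cell[OF L] by (simp add: set_lebesgue_integral_def scaleR_conv_of_real)
next
  case False
  then obtain j where j: "k $ j \<noteq> 0" by (auto simp: vec_eq_iff)
  have "grad (\<lambda>x. 1) = (\<lambda>x. 0)"
    by (auto simp: grad_def fun_eq_iff vec_eq_iff partial_eq[OF has_derivative_const])
  then have "has_weak_gradient (\<lambda>x. 1) (\<lambda>x. 0)"
    using smooth_has_weak_gradient[OF smooth_const[of 1]] by simp
  from fourier_coeff_weak_gradient[OF L this, of j k]
  have "fourier_coeff L (\<lambda>x. 1) k = 0"
    using L j by (simp add: cell_periodic_def fourier_coeff_wave set_lebesgue_integral_def wave_vector_def)
  with False L show ?thesis by (simp add: fourier_coeff_wave)
qed

lemma in_L2_imp_set_integrable: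
  fixes g :: "plane \<Rightarrow> real"
  assumes "in_Lp 2 (cell L) g"
  shows "set_integrable lebesgue (cell L) g"
  unfolding set_integrable_def
proof (rule Bochner_Integration.integrable_bound)
  have "integrable lebesgue (indicat_real (cell L))"
    by (intro integrable_real_indicator) (use emeasure_lborel_cbox_finite in \<open>auto simp: cell_def\<close>)
  then show "integrable lebesgue (\<lambda>x. indicator (cell L) x + indicator (cell L) x *\<^sub>R norm (g x) ^ 2)"
    using assms by (auto simp: in_Lp_def set_integrable_def)
  show "(\<lambda>x. indicator (cell L) x *\<^sub>R g x) \<in> borel_measurable lebesgue"
    using assms by (simp add: in_Lp_def set_borel_measurable_def)
  have "\<bar>y\<bar> \<le> 1 + y\<^sup>2" for y :: real
    using zero_le_power2[of "\<bar>y\<bar> - 1"] by (simp add: power2_diff)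
  then show "AE x in lebesgue. norm (indicator (cell L) x *\<^sub>R g x)
      \<le> norm (indicator (cell L) x + indicator (cell L) x *\<^sub>R norm (g x) ^ 2)"
    by (auto intro!: AE_I2 simp: indicator_def)
qed

lemma fourier_coeff_bessel:
  assumes L: "L > 0" and g: "in_Lp 2 (cell L) g" and F: "finite F"
  shows "(\<Sum>k\<in>F. (cmod (fourier_coeff L g k))\<^sup>2) \<le> (LINT x:cell L|lebesgue. (g x)\<^sup>2) / L\<^sup>2"
proof -
  let ?M = "lebesgue_on (cell L)"
  have "(\<Sum>k\<in>F. (cmod (LINT x|?M. of_real (g x) * wave L k x))\<^sup>2) \<le> L\<^sup>2 * (LINT x|?M. (g x)\<^sup>2)"
  proof (rule bessel_inequality[OF F])
    show "integrable ?M (\<lambda>x. (g x)\<^sup>2)"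
      using g by (subst set_integrable_eq[symmetric]) (auto simp: in_Lp_def)
    show "integrable ?M (\<lambda>x. of_real (g x) * wave L k x)" for k
      using set_integrable_mult_wave[OF in_L2_imp_set_integrable[OF g]]
      by (subst set_integrable_eq[symmetric]) auto
    show "has_bochner_integral ?M (\<lambda>x. wave L k x * cnj (wave L l x))
       (if k = l then complex_of_real (L\<^sup>2) else 0)" for k l
      unfolding wave_mult_cnj has_bochner_integral_iff
    proof
      have "set_integrable lebesgue (cell L) (wave L (k - l))"
        by (intro set_integrable_continuous_compact continuous_wave) simp
      then show "integrable ?M (wave L (k - l))"
        by (subst set_integrable_eq[symmetric]) auto
      show "integral\<^sup>L ?M (wave L (k - l)) = (if k = l then complex_of_real (L\<^sup>2) else 0)"
        using set_integral_wave[OF L, of "k - l"]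
        by (simp add: integral_restrict_space set_lebesgue_integral_def)
    qed
  qed (use L in simp)
  \<comment> \<open>\<open>fourier_coeff\<close> divides by L^2, hence its squared modulus by L^4;
    against the squared norm L^2 of a wave this leaves 1/L^2.\<close>
  then have "(\<Sum>k\<in>F. (cmod (LINT x|?M. of_real (g x) * wave L k x))\<^sup>2) / L ^ 4
      \<le> L\<^sup>2 * (LINT x|?M. (g x)\<^sup>2) / L ^ 4"
    by (rule divide_right_mono) simp
  moreover have "(cmod (fourier_coeff L g k))\<^sup>2 = (cmod (LINT x|?M. of_real (g x) * wave L k x))\<^sup>2 / L ^ 4" for k
    by (simp add: fourier_coeff_wave integral_restrict_space set_lebesgue_integral_def norm_divide
        power_divide norm_power flip: power_mult)
  moreover have "(LINT x:cell L|lebesgue. (g x)\<^sup>2) = (LINT x|?M. (g x)\<^sup>2)"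
    by (simp add: integral_restrict_space set_lebesgue_integral_def)
  moreover have "L\<^sup>2 * I / L ^ 4 = I / L\<^sup>2" for I
    using L by (simp add: field_simps power4_eq_xxxx power2_eq_square)
  ultimately show ?thesis
    by (simp flip: sum_divide_distrib)
qed

text \<open>The squared length of a wave vector is an integer, so a nonzero one has length at least
  1.\<close>

lemma norm_wave_vector_le: "norm (wave_vector k) \<le> (norm (wave_vector k))\<^sup>2"
proof (cases "k = 0")
  case False
  define m where "m = (k $ 1)\<^sup>2 + (k $ 2)\<^sup>2"
  have m: "(norm (wave_vector k))\<^sup>2 = of_int m"
    by (simp add: m_def norm_vec_def L2_set_def wave_vector_def sum_2)
  have "m > 0" using False by (auto simp: m_def vec_eq_iff forall_2 sum_power2_gt_zero_iff)
  then have "(norm (wave_vector k))\<^sup>2 \<ge> 1" unfolding m by linarith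
  then have "norm (wave_vector k) \<ge> 1" by (metis norm_ge_zero one_power2 power2_le_imp_le)
  then show ?thesis by (simp add: self_le_power)
qed (simp add: wave_vector_def vec_eq_iff flip: zero_vec_def)

text \<open>By the symbol formula, |k|^2 |f_k|^2 is L^2 / (4 pi^2) times the sum of the squared
  coefficients of the components of \<open>G\<close>; Bessel contributes 1/L^2. The two bounds share
  a proof because each needs the summability obtained on the way.\<close>

lemma
  assumes L: "L > 0" and per: "cell_periodic L f" and wg: "has_weak_gradient f G" and G: "in_Lp 2 (cell L) G"
  shows seminorm_H12_le: "(seminorm_H12 L f)\<^sup>2 \<le> (LINT x:cell L|lebesgue. (norm (G x))\<^sup>2) / (4 * pi\<^sup>2)"
    and seminorm_H12_ge: "norm (wave_vector k) * (cmod (fourier_coeff L f k))\<^sup>2 \<le> (seminorm_H12 L f)\<^sup>2"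
proof -
  define t where "t k = norm (wave_vector k) * (cmod (fourier_coeff L f k))\<^sup>2" for k
  define R where "R = (LINT x:cell L|lebesgue. (norm (G x))\<^sup>2) / (4 * pi\<^sup>2)"
  have Gj: "in_Lp 2 (cell L) (\<lambda>x. G x $ j)" for j
    unfolding in_Lp_def
  proof
    have m: "(\<lambda>x. indicator (cell L) x *\<^sub>R G x) \<in> borel_measurable lebesgue"
      using G by (simp add: in_Lp_def set_borel_measurable_def)
    have "(\<lambda>x. (indicator (cell L) x *\<^sub>R G x) \<bullet> axis j 1) \<in> borel_measurable lebesgue"
      using m by (intro borel_measurable_inner) auto
    then show b: "set_borel_measurable lebesgue (cell L) (\<lambda>x. G x $ j)"
      by (simp add: set_borel_measurable_def inner_axis)
    show "set_integrable lebesgue (cell L) (\<lambda>x. norm (G x $ j) ^ 2)"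
      unfolding set_integrable_def
    proof (rule Bochner_Integration.integrable_bound)
      show "integrable lebesgue (\<lambda>x. indicator (cell L) x *\<^sub>R norm (G x) ^ 2)"
        using G by (simp add: in_Lp_def set_integrable_def)
      have "(\<lambda>x. (indicator (cell L) x *\<^sub>R G x $ j)\<^sup>2) \<in> borel_measurable lebesgue"
        using b unfolding set_borel_measurable_def by (intro borel_measurable_power)
      moreover have "(\<lambda>x. (indicator (cell L) x *\<^sub>R G x $ j)\<^sup>2) = (\<lambda>x. indicator (cell L) x *\<^sub>R norm (G x $ j) ^ 2)"
        by (auto simp: fun_eq_iff indicator_def)
      ultimately show "(\<lambda>x. indicator (cell L) x *\<^sub>R norm (G x $ j) ^ 2) \<in> borel_measurable lebesgue"
        by simp
      show "AE x in lebesgue. norm (indicator (cell L) x *\<^sub>R norm (G x $ j) ^ 2)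
         \<le> norm (indicator (cell L) x *\<^sub>R norm (G x) ^ 2)"
        using component_le_norm_cart by (auto intro!: AE_I2 power_mono simp: indicator_def abs_le_square_iff[symmetric])
    qed
  qed
  have sum_le: "sum t F \<le> R" if "finite F" for F
  proof -
    have t: "t k \<le> (L\<^sup>2 / (4 * pi\<^sup>2)) * (\<Sum>j\<in>UNIV. (cmod (fourier_coeff L (\<lambda>x. G x $ j) k))\<^sup>2)" for k
    proof -
      have "t k \<le> (norm (wave_vector k))\<^sup>2 * (cmod (fourier_coeff L f k))\<^sup>2"
        unfolding t_def by (intro mult_right_mono norm_wave_vector_le) auto
      also have "\<dots> = (L\<^sup>2 / (4 * pi\<^sup>2)) * (\<Sum>j\<in>UNIV. (cmod (fourier_coeff L (\<lambda>x. G x $ j) k))\<^sup>2)"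
        using L unfolding fourier_coeff_weak_gradient[OF L wg per]
        by (simp add: norm_mult norm_divide power_mult_distrib power_divide norm_vec_def L2_set_def sum_2 field_simps)
      finally show ?thesis .
    qed
    have "sum t F \<le> (\<Sum>k\<in>F. (L\<^sup>2 / (4 * pi\<^sup>2)) * (\<Sum>j\<in>UNIV. (cmod (fourier_coeff L (\<lambda>x. G x $ j) k))\<^sup>2))"
      by (intro sum_mono t)
    also have "\<dots> = (L\<^sup>2 / (4 * pi\<^sup>2)) * (\<Sum>j\<in>UNIV. \<Sum>k\<in>F. (cmod (fourier_coeff L (\<lambda>x. G x $ j) k))\<^sup>2)"
      by (subst sum.swap) (simp add: sum_distrib_left)
    also have "\<dots> \<le> (L\<^sup>2 / (4 * pi\<^sup>2)) * (\<Sum>j\<in>UNIV. (LINT x:cell L|lebesgue. (G x $ j)\<^sup>2) / L\<^sup>2)"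
      by (intro mult_left_mono sum_mono fourier_coeff_bessel[OF L Gj that]) auto
    also have "\<dots> = (\<Sum>j\<in>UNIV. (LINT x:cell L|lebesgue. (G x $ j)\<^sup>2)) / (4 * pi\<^sup>2)"
      using L by (simp add: sum_2 field_simps)
    also have "(\<Sum>j\<in>UNIV. (LINT x:cell L|lebesgue. (G x $ j)\<^sup>2)) = (LINT x:cell L|lebesgue. (\<Sum>j\<in>UNIV. (G x $ j)\<^sup>2))"
      using Gj unfolding sum_2 by (subst set_integral_add) (auto simp: in_Lp_def)
    also have "\<dots> = (LINT x:cell L|lebesgue. (norm (G x))\<^sup>2)"
      by (simp add: norm_vec_def L2_set_def sum_nonneg)
    finally show ?thesis by (simp add: R_def)
  qed
  have nn: "t k \<ge> 0" for k by (simp add: t_def)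
  \<comment> \<open>Without summability \<open>infsum\<close> would be 0, and no single term could
    bound the seminorm from below.\<close>
  have summ: "t summable_on UNIV"
    using sum_le nn by (intro nonneg_bdd_above_summable_on bdd_aboveI2[of _ _ R]) auto
  have sq: "(seminorm_H12 L f)\<^sup>2 = infsum t UNIV"
    using infsum_nonneg[of UNIV t] nn by (simp add: seminorm_H12_def t_def[abs_def])
  show "(seminorm_H12 L f)\<^sup>2 \<le> (LINT x:cell L|lebesgue. (norm (G x))\<^sup>2) / (4 * pi\<^sup>2)"
    unfolding sq R_def[symmetric] using sum_le by (intro infsum_le_finite_sums summ) auto
  have "infsum t {k} \<le> infsum t UNIV"
    by (intro infsum_mono_neutral summ) (auto simp: nn)
  then show "norm (wave_vector k) * (cmod (fourier_coeff L f k))\<^sup>2 \<le> (seminorm_H12 L f)\<^sup>2"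
    unfolding sq by (simp add: t_def)
qed

subsection \<open>Energy bounds\<close>

lemma Ck_real_id: "Ck_real n (\<lambda>t. t)"
  by (cases n) (auto intro!: exI[of _ "\<lambda>_. 1"] simp: Ck_real_const)

lemma smooth_inner: "smooth (\<lambda>x. B \<bullet> x)"
  using smooth_ridge[OF Ck_real_id, of B 0] by simp

lemma grad_inner: "grad (\<lambda>x. B \<bullet> x) x = B"
  using partial_ridge[of "\<lambda>t. t" "\<lambda>_. 1" _ B 0 x] by (simp add: grad_def vec_eq_iff)

lemma has_weak_gradient_detrend:
  assumes "has_weak_gradient h G"
  shows "has_weak_gradient (detrend B h) (\<lambda>x. G x - B)"
  using has_weak_gradient_diff[OF assms smooth_has_weak_gradient[OF smooth_inner[of B]]]
  by (simp add: grad_inner detrend_def)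

text \<open>The choice of \<open>\<gamma>0\<close> gives ln \<open>\<gamma>0\<close> = -c2/c1, so
  logarithm and linear term are jointly nonnegative. For the upper bound ln x <= x suffices: it
  replaces the logarithmic term by a quadratic one with a factor \<open>a\<close>, of order 1/a for
  slopes of order 1/a.\<close>

lemma
  assumes "c1 > 0" "c3 > 0" "\<gamma>0 = exp (- c2 / c1)" "a > 0"
  shows Psi_ge: "a * c3 * norm p ^ 3 \<le> Psi c1 c2 c3 \<gamma>0 a p"
    and Psi_le: "Psi c1 c2 c3 \<gamma>0 a p \<le>
      a * c1 * (norm p)\<^sup>2 + a * (c1 * \<gamma>0 + \<bar>c2\<bar>) * norm p + a * c3 * norm p ^ 3"
proof -
  have g: "\<gamma>0 > 0" using assms by simp
  have "ln \<gamma>0 \<le> ln (norm p + \<gamma>0)" using g by (subst ln_le_cancel_iff) (auto simp: add_nonneg_pos)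
  then have "- c2 / c1 \<le> ln (norm p + \<gamma>0)" using assms(3) by simp
  then have "0 \<le> c1 * ln (norm p + \<gamma>0) + c2" using assms(1) by (simp add: field_simps)
  then have "0 \<le> a * norm p * (c1 * ln (norm p + \<gamma>0) + c2)" using assms(4) by simp
  then show "a * c3 * norm p ^ 3 \<le> Psi c1 c2 c3 \<gamma>0 a p" by (simp add: Psi_def algebra_simps)
  have "norm p + \<gamma>0 > 0" using g by (simp add: add_nonneg_pos)
  then have "ln (norm p + \<gamma>0) \<le> norm p + \<gamma>0" using ln_less_self less_imp_le by blast
  then have "c1 * ln (norm p + \<gamma>0) \<le> c1 * (norm p + \<gamma>0)" using assms(1) by (intro mult_left_mono) auto
  then have "c1 * ln (norm p + \<gamma>0) + c2 \<le> c1 * norm p + (c1 * \<gamma>0 + \<bar>c2\<bar>)"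
    by (simp add: algebra_simps)
  then have "a * norm p * (c1 * ln (norm p + \<gamma>0) + c2) \<le> a * norm p * (c1 * norm p + (c1 * \<gamma>0 + \<bar>c2\<bar>))"
    using assms(4) by (intro mult_left_mono) auto
  then show "Psi c1 c2 c3 \<gamma>0 a p \<le>
      a * c1 * (norm p)\<^sup>2 + a * (c1 * \<gamma>0 + \<bar>c2\<bar>) * norm p + a * c3 * norm p ^ 3"
    by (simp add: Psi_def algebra_simps power2_eq_square)
qed

lemma continuous_Psi: "\<gamma>0 > 0 \<Longrightarrow> continuous_on UNIV (Psi c1 c2 c3 \<gamma>0 a)"
  unfolding Psi_def[abs_def] by (intro continuous_intros) (auto simp: add_nonneg_eq_0_iff)

lemma le_one_plus_cube: 
  fixes x :: real assumes "x \<ge> 0" shows "x \<le> 1 + x ^ 3" "x\<^sup>2 \<le> 1 + x ^ 3"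
proof -
  show "x \<le> 1 + x ^ 3"
  proof (cases "x \<ge> 1")
    case True
    then show ?thesis using self_le_power[of x 3] by simp
  next
    case False
    then show ?thesis using zero_le_power[OF assms, of 3] by linarith
  qed
  show "x\<^sup>2 \<le> 1 + x ^ 3"
  proof (cases "x \<ge> 1")
    case True
    then show ?thesis using power_increasing[of 2 3 x] by simp
  next
    case False
    then show ?thesis using power_le_one[OF assms, of 2] zero_le_power[OF assms, of 3] by linarith
  qed
qed

lemma set_integrable_cell_const: "set_integrable lebesgue (cell L) (\<lambda>x. c :: real)"
  by (intro set_integrable_continuous_compact) auto

lemma set_integrable_cubic_growth:
  fixes G :: "plane \<Rightarrow> plane" and \<Phi> :: "plane \<Rightarrow> real"
  assumes G: "in_Lp 3 (cell L) G" and \<Phi>: "continuous_on UNIV \<Phi>" "\<And>p. \<bar>\<Phi> p\<bar> \<le> A * (1 + norm p ^ 3)"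
  shows "set_integrable lebesgue (cell L) (\<lambda>x. \<Phi> (G x))"
  unfolding set_integrable_def
proof (rule Bochner_Integration.integrable_bound)
  have "set_integrable lebesgue (cell L) (\<lambda>x. A * (1 + norm (G x) ^ 3))"
    using G by (intro set_integrable_mult_right set_integral_add(1) set_integrable_cell_const) (auto simp: in_Lp_def)
  then show "integrable lebesgue (\<lambda>x. indicator (cell L) x *\<^sub>R (A * (1 + norm (G x) ^ 3)))"
    by (simp add: set_integrable_def)
  have m: "(\<lambda>x. indicator (cell L) x *\<^sub>R G x) \<in> borel_measurable lebesgue"
    using G by (simp add: in_Lp_def set_borel_measurable_def)
  \<comment> \<open>Only the cut-off \<open>G\<close> is known to be measurable. The indicator is
    therefore also placed inside \<open>\<Phi>\<close>, where it changes nothing on the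
    cell.\<close>
  have "(\<lambda>x. indicator (cell L) x *\<^sub>R \<Phi> (indicator (cell L) x *\<^sub>R G x)) \<in> borel_measurable lebesgue"
    by (intro borel_measurable_scaleR measurable_compose[OF m borel_measurable_continuous_onI[OF \<Phi>(1)]]
        borel_measurable_indicator) simp
  moreover have "(\<lambda>x. indicator (cell L) x *\<^sub>R \<Phi> (indicator (cell L) x *\<^sub>R G x)) = (\<lambda>x. indicator (cell L) x *\<^sub>R \<Phi> (G x))"
    by (auto simp: fun_eq_iff indicator_def)
  ultimately show "(\<lambda>x. indicator (cell L) x *\<^sub>R \<Phi> (G x)) \<in> borel_measurable lebesgue" by simp
  show "AE x in lebesgue. norm (indicator (cell L) x *\<^sub>R \<Phi> (G x)) \<le> norm (indicator (cell L) x *\<^sub>R (A * (1 + norm (G x) ^ 3)))"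
    using order_trans[OF \<Phi>(2) abs_ge_self] by (auto intro!: AE_I2 simp: indicator_def)
qed

lemma set_integral_cell_const: "L > 0 \<Longrightarrow> (LINT x:cell L|lebesgue. c) = c * L\<^sup>2" for c :: real
  using measure_cell[of L] by (simp add: set_lebesgue_integral_def)

lemma continuous_in_Lp:
  assumes "continuous_on UNIV f" "compact K"
  shows "in_Lp p K f"
  unfolding in_Lp_def
proof
  have "K \<in> sets lebesgue" using assms(2) by (simp add: compact_imp_closed)
  then show "set_borel_measurable lebesgue K f"
    unfolding set_borel_measurable_def
    by (intro borel_measurable_scaleR borel_measurable_indicator continuous_lebesgue_measurable assms)
  show "set_integrable lebesgue K (\<lambda>x. norm (f x) ^ p)"
    by (intro set_integrable_continuous_compact continuous_intros continuous_on_subset[OF assms(1)] assms(2)) auto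
qed

lemma weak_gradient_has_weak_gradient:
  "h \<in> X_space L B \<Longrightarrow> has_weak_gradient h (weak_gradient h)"
  unfolding weak_gradient_def by (rule someI_ex[of "has_weak_gradient h"]) (auto simp: X_space_def H1_loc_def)

lemma norm_diff_square_le: "(norm (p - B))\<^sup>2 \<le> 2 * (norm p)\<^sup>2 + 2 * (norm B)\<^sup>2"
  for p B :: "'a::real_inner"
proof -
  have "0 \<le> (norm (p + B))\<^sup>2" by simp
  then show ?thesis unfolding power2_norm_eq_inner by (simp add: inner_simps inner_commute)
qed

text \<open>The crossover is at p = A/b: above it the cubic term dominates, below it the quadratic
  term is at most A (A/b)^2. With \<open>b\<close> proportional to \<open>a\<close> the constant is
  of order a^(-2).\<close>

lemma square_le_cube_plus:
  fixes p :: real assumes "p \<ge> 0" "A > 0" "b > 0"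
  shows "A * p\<^sup>2 \<le> b * p ^ 3 + A ^ 3 / b\<^sup>2"
proof (cases "A \<le> b * p")
  case True
  then have "A * p\<^sup>2 \<le> (b * p) * p\<^sup>2" by (intro mult_right_mono) auto
  also have "\<dots> = b * p ^ 3" by (simp add: power2_eq_square power3_eq_cube)
  also have "0 \<le> A ^ 3 / b\<^sup>2" using assms by simp
  ultimately show ?thesis by linarith
next
  case False
  then have "p \<le> A / b" using assms by (simp add: field_simps)
  then have "p\<^sup>2 \<le> (A / b)\<^sup>2" using assms by (intro power_mono) auto
  then have "A * p\<^sup>2 \<le> A * (A / b)\<^sup>2" using assms by (intro mult_left_mono) auto
  also have "\<dots> = A ^ 3 / b\<^sup>2" by (simp add: power_divide power2_eq_square power3_eq_cube)
  also have "0 \<le> b * p ^ 3" using assms by simp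
  ultimately show ?thesis by linarith
qed

lemma energy_lower_bound:
  assumes L: "L > 0" and c: "c1 > 0" "c3 > 0" "\<gamma>0 = exp (- c2 / c1)" and a: "a > 0"
    and h: "h \<in> X_space L B"
  shows "ereal (- (((c1 * L) ^ 3 / (a * c3)\<^sup>2 + c1 * L * (norm B)\<^sup>2) * L\<^sup>2)) \<le> energy L B c1 c2 c3 \<gamma>0 a h"
proof (cases "in_Lp 3 (cell L) (weak_gradient h)")
  case True
  define G where "G = weak_gradient h"
  define D where "D = (c1 * L) ^ 3 / (a * c3)\<^sup>2 + c1 * L * (norm B)\<^sup>2"
  have wg: "has_weak_gradient (detrend B h) (\<lambda>x. G x - B)"
    unfolding G_def by (rule has_weak_gradient_detrend[OF weak_gradient_has_weak_gradient[OF h]])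
  have per: "cell_periodic L (detrend B h)" using h by (simp add: X_space_def V_space_def H1_per_def)
  have G3: "in_Lp 3 (cell L) G" using True by (simp add: G_def)
  have int2: "set_integrable lebesgue (cell L) (\<lambda>x. (norm (G x - B))\<^sup>2)"
  proof (rule set_integrable_cubic_growth[OF G3])
    show "continuous_on UNIV (\<lambda>p. (norm (p - B))\<^sup>2)" by (intro continuous_intros)
    fix p :: plane
    have "(norm (p - B))\<^sup>2 \<le> 2 * (norm p)\<^sup>2 + 2 * (norm B)\<^sup>2" by (rule norm_diff_square_le)
    also have "\<dots> \<le> 2 * (1 + norm p ^ 3) + 2 * (norm B)\<^sup>2 * (1 + norm p ^ 3)"
    proof (rule add_mono)
      show "2 * (norm B)\<^sup>2 \<le> 2 * (norm B)\<^sup>2 * (1 + norm p ^ 3)"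
        by (simp add: mult_le_cancel_left1)
    qed (use le_one_plus_cube[of "norm p"] in simp)
    finally show "\<bar>(norm (p - B))\<^sup>2\<bar> \<le> (2 + 2 * (norm B)\<^sup>2) * (1 + norm p ^ 3)"
      by (simp add: algebra_simps)
  qed
  have G2: "in_Lp 2 (cell L) (\<lambda>x. G x - B)"
    unfolding in_Lp_def
  proof
    have "(\<lambda>x. indicator (cell L) x *\<^sub>R G x - indicator (cell L) x *\<^sub>R B) \<in> borel_measurable lebesgue"
    proof (rule borel_measurable_diff)
      show "(\<lambda>x. indicator (cell L) x *\<^sub>R G x) \<in> borel_measurable lebesgue"
        using G3 by (simp add: in_Lp_def set_borel_measurable_def)
    qed (intro borel_measurable_scaleR borel_measurable_indicator borel_measurable_const, simp)
    then show "set_borel_measurable lebesgue (cell L) (\<lambda>x. G x - B)"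
      by (simp add: set_borel_measurable_def scaleR_diff_right)
  qed (rule int2)
  have intPsi: "set_integrable lebesgue (cell L) (\<lambda>x. Psi c1 c2 c3 \<gamma>0 a (G x))"
  proof (rule set_integrable_cubic_growth[OF G3])
    show "continuous_on UNIV (Psi c1 c2 c3 \<gamma>0 a)" using c by (intro continuous_Psi) simp
    fix p :: plane
    define q where "q = norm p"
    have q: "q \<le> 1 + q ^ 3" "q\<^sup>2 \<le> 1 + q ^ 3" "q ^ 3 \<le> 1 + q ^ 3" "q \<ge> 0"
      using le_one_plus_cube[of q] by (auto simp: q_def)
    have "0 \<le> c1 * \<gamma>0 + \<bar>c2\<bar>" using c by simp
    then have "a * c1 * q\<^sup>2 + a * (c1 * \<gamma>0 + \<bar>c2\<bar>) * q + a * c3 * q ^ 3 \<le>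
       a * c1 * (1 + q ^ 3) + a * (c1 * \<gamma>0 + \<bar>c2\<bar>) * (1 + q ^ 3) + a * c3 * (1 + q ^ 3)"
      using a c by (intro add_mono mult_left_mono q) auto
    moreover have "0 \<le> a * c3 * q ^ 3" using a c q by simp
    ultimately show "\<bar>Psi c1 c2 c3 \<gamma>0 a p\<bar> \<le> (a * c1 + a * (c1 * \<gamma>0 + \<bar>c2\<bar>) + a * c3) * (1 + norm p ^ 3)"
      using Psi_ge[OF c a, of p] Psi_le[OF c a, of p] unfolding q_def distrib_right by linarith
  qed
  \<comment> \<open>The factor c1 L / 2 is the energy's coefficient 2 c1 pi^2 L divided by the 4
    pi^2 of \<open>seminorm_H12_le\<close>. Splitting off \<open>B\<close> doubles it, so the
    quadratic-cubic inequality is used with A = c1 L.\<close>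
  have pw: "c1 * L / 2 * (norm (G x - B))\<^sup>2 - D \<le> Psi c1 c2 c3 \<gamma>0 a (G x)" for x
  proof -
    have "c1 * L / 2 * (norm (G x - B))\<^sup>2 \<le> c1 * L / 2 * (2 * (norm (G x))\<^sup>2 + 2 * (norm B)\<^sup>2)"
      using c L by (intro mult_left_mono norm_diff_square_le) auto
    also have "\<dots> = c1 * L * (norm (G x))\<^sup>2 + c1 * L * (norm B)\<^sup>2" by (simp add: algebra_simps)
    finally show ?thesis
      using square_le_cube_plus[of "norm (G x)" "c1 * L" "a * c3"] Psi_ge[OF c a, of "G x"] c L a
      by (simp add: D_def)
  qed
  have "(LINT x:cell L|lebesgue. c1 * L / 2 * (norm (G x - B))\<^sup>2 - D) \<le> (LINT x:cell L|lebesgue. Psi c1 c2 c3 \<gamma>0 a (G x))"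
    by (intro set_integral_mono intPsi pw set_integral_diff(1) set_integrable_mult_right int2 set_integrable_cell_const)
  also have "(LINT x:cell L|lebesgue. c1 * L / 2 * (norm (G x - B))\<^sup>2 - D) =
      c1 * L / 2 * (LINT x:cell L|lebesgue. (norm (G x - B))\<^sup>2) - D * L\<^sup>2"
    using L int2 by (subst set_integral_diff(2)) (auto simp: set_integrable_cell_const set_integral_cell_const)
  finally have Psi_int: "c1 * L / 2 * (LINT x:cell L|lebesgue. (norm (G x - B))\<^sup>2) - D * L\<^sup>2
     \<le> (LINT x:cell L|lebesgue. Psi c1 c2 c3 \<gamma>0 a (G x))" .
  have "2 * c1 * pi\<^sup>2 * L * (seminorm_H12 L (detrend B h))\<^sup>2 \<le>
      2 * c1 * pi\<^sup>2 * L * ((LINT x:cell L|lebesgue. (norm (G x - B))\<^sup>2) / (4 * pi\<^sup>2))"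
    using c L by (intro mult_left_mono seminorm_H12_le[OF L per wg G2]) auto
  also have "\<dots> = c1 * L / 2 * (LINT x:cell L|lebesgue. (norm (G x - B))\<^sup>2)"
    by (simp add: field_simps)
  finally show ?thesis
    using Psi_int True by (simp add: energy_def G_def D_def)
qed (simp add: energy_def)

section \<open>The cosine competitor\<close>

lemma wave_mult: "wave L k x * wave L l x = wave L (k + l) x"
  unfolding wave_altdef cis_mult
  by (rule arg_cong[of _ _ cis])
     (simp add: wave_vector_def inner_vec_def sum_2 add_divide_distrib algebra_simps)

lemma norm_wave_vector_axis: "norm (wave_vector (axis 1 1)) = 1"
  by (simp add: wave_vector_def norm_vec_def L2_set_def sum_2 axis_component)

definition ripple :: "real \<Rightarrow> real \<Rightarrow> plane \<Rightarrow> real" where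
  "ripple L s x = s * cos (2 * pi / L * x $ 1)"

text \<open>The ripple consists of two modes of wave-vector length 1, each with coefficient s/2, so
  its Fourier data follow from the integrals of waves alone.\<close>

lemma ripple_wave: "complex_of_real (ripple L s x) = of_real s / 2 * (wave L (axis 1 1) x + wave L (- axis 1 1) x)"
  by (simp add: ripple_def wave_altdef wave_vector_def inner_vec_def sum_2 axis_component complex_eq_iff)

lemma smooth_ripple: "smooth (ripple L s)"
  unfolding ripple_def[abs_def] using smooth_coord[of cos "2 * pi / L" 1 0] Ck_real_sin_cos
  by (intro smooth_mult smooth_const) auto

lemma norm_grad_ripple_le: "norm (grad (ripple L s) x) \<le> \<bar>s * (2 * pi / L)\<bar>"
proof -
  have d: "((\<lambda>t. s * cos t) has_real_derivative s * - sin t) (at t)" for t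
    by (auto intro!: derivative_eq_intros)
  have "partial i (ripple L s) x = - sin (2 * pi / L * x $ 1) * (if i = 1 then s * (2 * pi / L) else 0)" for i
    using partial_ridge[OF d, of i "axis 1 (2 * pi / L)" 0 x]
    by (auto simp: ripple_def[abs_def] inner_axis' axis_component)
  then have "grad (ripple L s) x = axis 1 (- sin (2 * pi / L * x $ 1) * (s * (2 * pi / L)))"
    by (simp add: grad_def vec_eq_iff axis_component)
  moreover have "norm (axis 1 r :: plane) = \<bar>r\<bar>" for r
    by (simp add: norm_vec_def L2_set_def sum_2 axis_component)
  ultimately have "norm (grad (ripple L s) x) = \<bar>sin (2 * pi / L * x $ 1)\<bar> * \<bar>s * (2 * pi / L)\<bar>"
    by (simp only: abs_mult abs_minus_cancel)
  also have "\<dots> \<le> 1 * \<bar>s * (2 * pi / L)\<bar>" by (intro mult_right_mono) auto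
  finally show ?thesis by simp
qed

lemma set_integrable_wave: "set_integrable lebesgue (cell L) (wave L k)"
  by (intro set_integrable_continuous_compact continuous_wave) simp

lemma
  assumes L: "L > 0"
  shows set_integral_ripple: "(LINT x:cell L|lebesgue. ripple L s x) = 0"
    and fourier_coeff_ripple: "fourier_coeff L (ripple L s) (axis 1 1) = s / 2"
proof -
  let ?k = "axis 1 1 :: int ^ 2"
  have ne: "?k \<noteq> 0" "- ?k \<noteq> 0" "?k + ?k \<noteq> 0" by (simp_all add: vec_eq_iff axis_component forall_2)
  have sum: "(LINT x:cell L|lebesgue. of_real s / 2 * (wave L k x + wave L l x)) =
      of_real s / 2 * ((LINT x:cell L|lebesgue. wave L k x) + (LINT x:cell L|lebesgue. wave L l x))" for k l
    by (subst set_integral_mult_right, subst set_integral_add(2)) (simp_all add: set_integrable_wave)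
  have "complex_of_real (LINT x:cell L|lebesgue. ripple L s x) = (LINT x:cell L|lebesgue. of_real s / 2 * (wave L ?k x + wave L (- ?k) x))"
    by (simp only: ripple_wave[symmetric] set_integral_complex_of_real)
  then show "(LINT x:cell L|lebesgue. ripple L s x) = 0"
    unfolding sum set_integral_wave[OF L] using ne by simp
  have prod: "complex_of_real (ripple L s x) * wave L ?k x = of_real s / 2 * (wave L (?k + ?k) x + wave L 0 x)" for x
    unfolding ripple_wave by (simp add: distrib_right wave_mult mult.assoc del: wave_0)
  have "(LINT x:cell L|lebesgue. complex_of_real (ripple L s x) * wave L ?k x) = of_real s / 2 * of_real (L\<^sup>2)"
    unfolding prod sum set_integral_wave[OF L] using ne by simp
  then show "fourier_coeff L (ripple L s) ?k = s / 2"
    using L by (simp add: fourier_coeff_wave)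
qed

lemma cell_periodic_ripple: "L > 0 \<Longrightarrow> cell_periodic L (ripple L s)"
proof -
  assume L: "L > 0"
  have shift: "2 * pi / L * (x + axis i L) $ 1 = 2 * pi / L * x $ 1 + 2 * pi * of_int (if i = 1 then 1 else 0)" for x i
    using L by (simp add: axis_component field_simps)
  have "ripple L s (x + axis i L) = ripple L s x" for x i
    unfolding ripple_def shift cos_add cos_int_2pin sin_int_2pin by simp
  then show ?thesis by (simp add: cell_periodic_def)
qed

lemma detrend_ripple: "detrend B (\<lambda>x. ripple L s x + B \<bullet> x) = ripple L s"
  by (simp add: detrend_def)

lemma ripple_in_X_space:
  assumes L: "L > 0"
  shows "(\<lambda>x. ripple L s x + B \<bullet> x) \<in> X_space L B"
proof -
  have sm: "smooth (\<lambda>x. ripple L s x + B \<bullet> x)" by (intro smooth_add smooth_ripple smooth_inner)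
  have 1: "(\<lambda>x. ripple L s x + B \<bullet> x) \<in> H1_loc"
    unfolding H1_loc_def
    by (auto intro!: exI[of _ "grad (\<lambda>x. ripple L s x + B \<bullet> x)"] continuous_in_Lp smooth_continuous
        continuous_grad smooth_has_weak_gradient sm)
  have 2: "ripple L s \<in> V_space L"
    unfolding V_space_def H1_per_def
    by (auto intro!: exI[of _ "grad (ripple L s)"] continuous_in_Lp smooth_continuous
        continuous_grad smooth_has_weak_gradient smooth_ripple cell_periodic_ripple L set_integral_ripple)
  from 1 2 show ?thesis by (simp add: X_space_def detrend_ripple)
qed

text \<open>The bound in \<open>Psi_le\<close> increases with the slope, so a uniform slope bound
  \<open>M\<close> turns the integral into a constant times the area. Keeping just one of the two
  modes in the seminorm gives (s/2)^2.\<close>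

lemma energy_ripple_le:
  assumes L: "L > 0" and c: "c1 > 0" "c3 > 0" "\<gamma>0 = exp (- c2 / c1)" and a: "a > 0" and s: "s > 0"
    and M: "s * (2 * pi / L) + norm B \<le> M"
  shows "energy L B c1 c2 c3 \<gamma>0 a (\<lambda>x. ripple L s x + B \<bullet> x) \<le>
    ereal (- 2 * c1 * pi\<^sup>2 * L * (s / 2)\<^sup>2 + (a * c1 * M\<^sup>2 + a * (c1 * \<gamma>0 + \<bar>c2\<bar>) * M + a * c3 * M ^ 3) * L\<^sup>2)"
proof -
  let ?h = "\<lambda>x. ripple L s x + B \<bullet> x"
  define G where "G = weak_gradient ?h"
  define P where "P = a * c1 * M\<^sup>2 + a * (c1 * \<gamma>0 + \<bar>c2\<bar>) * M + a * c3 * M ^ 3"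
  have sm: "smooth ?h" by (intro smooth_add smooth_ripple smooth_inner)
  have wG: "has_weak_gradient ?h G"
    unfolding G_def by (rule weak_gradient_has_weak_gradient[OF ripple_in_X_space[OF L]])
  \<comment> \<open>The energy sees the chosen weak gradient; uniqueness allows all integrals to be
    computed with the classical one.\<close>
  have eq: "AE x in lebesgue. G x = grad ?h x"
    by (rule has_weak_gradient_unique[OF wG smooth_has_weak_gradient[OF sm]])
  have measG: "G \<in> borel_measurable lebesgue"
    using wG locally_integrable_measurable by (auto simp: has_weak_gradient_def)
  have contg: "continuous_on S (grad ?h)" for S by (rule continuous_grad[OF sm])
  have contP: "continuous_on UNIV (Psi c1 c2 c3 \<gamma>0 a)" using c by (intro continuous_Psi) simp
  have G3: "in_Lp 3 (cell L) G"
    unfolding in_Lp_def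
  proof
    show "set_borel_measurable lebesgue (cell L) G"
      unfolding set_borel_measurable_def using measG
      by (intro borel_measurable_scaleR borel_measurable_indicator) auto
    have "integrable lebesgue (\<lambda>x. indicator (cell L) x *\<^sub>R norm (grad ?h x) ^ 3)"
      using continuous_in_Lp[OF contg, of "cell L" 3] by (auto simp: in_Lp_def set_integrable_def)
    then show "set_integrable lebesgue (cell L) (\<lambda>x. norm (G x) ^ 3)"
      unfolding set_integrable_def
    proof (rule integrable_cong_AE_imp)
      show "(\<lambda>x. indicator (cell L) x *\<^sub>R norm (G x) ^ 3) \<in> borel_measurable lebesgue"
        using measG by (intro borel_measurable_scaleR borel_measurable_indicator borel_measurable_power
            borel_measurable_norm) auto
      show "AE x in lebesgue. indicator (cell L) x *\<^sub>R norm (grad ?h x) ^ 3 = indicator (cell L) x *\<^sub>R norm (G x) ^ 3"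
        using eq by eventually_elim simp
    qed
  qed
  have grad_le: "norm (grad ?h x) \<le> M" for x
  proof -
    have "grad ?h x = grad (ripple L s) x + B"
      using grad_inner[of B x] smooth_ripple[of L s] smooth_inner[of B]
      by (simp add: grad_def vec_eq_iff partial_add smooth_differentiable)
    then have "norm (grad ?h x) \<le> norm (grad (ripple L s) x) + norm B" by (simp add: norm_triangle_ineq)
    then show ?thesis using norm_grad_ripple_le[of L s x] M s L by (simp add: abs_mult)
  qed
  have PsiP: "Psi c1 c2 c3 \<gamma>0 a (grad ?h x) \<le> P" for x
  proof -
    have "0 \<le> c1 * \<gamma>0 + \<bar>c2\<bar>" using c by simp
    then have "a * c1 * (norm (grad ?h x))\<^sup>2 + a * (c1 * \<gamma>0 + \<bar>c2\<bar>) * norm (grad ?h x) + a * c3 * norm (grad ?h x) ^ 3 \<le> P"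
      unfolding P_def using a c grad_le by (intro add_mono mult_left_mono power_mono) auto
    then show ?thesis using Psi_le[OF c a, of "grad ?h x"] by linarith
  qed
  have "(LINT x:cell L|lebesgue. Psi c1 c2 c3 \<gamma>0 a (G x)) = (LINT x:cell L|lebesgue. Psi c1 c2 c3 \<gamma>0 a (grad ?h x))"
    unfolding set_lebesgue_integral_def
  proof (rule integral_cong_AE)
    show "(\<lambda>x. indicator (cell L) x *\<^sub>R Psi c1 c2 c3 \<gamma>0 a (G x)) \<in> borel_measurable lebesgue"
      by (intro borel_measurable_scaleR borel_measurable_indicator
          measurable_compose[OF measG borel_measurable_continuous_onI[OF contP]]) auto
    show "(\<lambda>x. indicator (cell L) x *\<^sub>R Psi c1 c2 c3 \<gamma>0 a (grad ?h x)) \<in> borel_measurable lebesgue"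
      by (intro borel_measurable_scaleR borel_measurable_indicator
          measurable_compose[OF continuous_lebesgue_measurable[OF contg] borel_measurable_continuous_onI[OF contP]]) auto
    show "AE x in lebesgue. indicator (cell L) x *\<^sub>R Psi c1 c2 c3 \<gamma>0 a (G x) = indicator (cell L) x *\<^sub>R Psi c1 c2 c3 \<gamma>0 a (grad ?h x)"
      using eq by eventually_elim simp
  qed
  also have "\<dots> \<le> (LINT x:cell L|lebesgue. P)"
    by (intro set_integral_mono set_integrable_cell_const PsiP set_integrable_continuous_compact
        continuous_on_compose2[OF contP contg]) auto
  also have "\<dots> = P * L\<^sup>2" using set_integral_cell_const[OF L] .
  finally have int: "(LINT x:cell L|lebesgue. Psi c1 c2 c3 \<gamma>0 a (G x)) \<le> P * L\<^sup>2" .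
  have "in_Lp 2 (cell L) (grad (ripple L s))"
    by (intro continuous_in_Lp continuous_grad smooth_ripple) simp
  from seminorm_H12_ge[OF L cell_periodic_ripple[OF L] smooth_has_weak_gradient[OF smooth_ripple] this, of "axis 1 1"]
  have "(s / 2)\<^sup>2 \<le> (seminorm_H12 L (ripple L s))\<^sup>2"
    using s by (simp add: fourier_coeff_ripple[OF L] norm_wave_vector_axis norm_divide)
  then have "2 * c1 * pi\<^sup>2 * L * (s / 2)\<^sup>2 \<le> 2 * c1 * pi\<^sup>2 * L * (seminorm_H12 L (ripple L s))\<^sup>2"
    using c L by (intro mult_left_mono) auto
  with int G3 show ?thesis
    unfolding energy_def detrend_ripple G_def P_def by simp
qed

theorem theorem3:
  fixes L c1 c2 c3 \<gamma>0 :: real and B :: "real ^ 2"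
  assumes "L > 0" and "c1 > 0" and "c3 > 0" and "\<gamma>0 = exp (- c2 / c1)"
  shows "\<exists>C1 > 0. \<exists>C2 > 0. \<forall>\<^sub>F a in at_right 0.
           ereal (- C1 / a\<^sup>2) \<le> (INF h \<in> X_space L B. energy L B c1 c2 c3 \<gamma>0 a h) \<and>
           (INF h \<in> X_space L B. energy L B c1 c2 c3 \<gamma>0 a h) \<le> ereal (- C2 / a\<^sup>2)"
proof -
  note L = assms(1) and c = assms(2-4)
  \<comment> \<open>With this \<open>\<tau>\<close> the cubic term uses up a quarter of the gain from the seminorm, see \<open>e5\<close>.\<close>
  define \<tau> where "\<tau> = c1 * L / (256 * c3)"
  define d where "d = c1 * \<gamma>0 + \<bar>c2\<bar>"
  define C1 where "C1 = ((c1 * L) ^ 3 / c3\<^sup>2 + c1 * L * (norm B)\<^sup>2) * L\<^sup>2"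
  \<comment> \<open>In units of c1 L^3 \<open>\<tau>\<close>^2 / a^2 the seminorm gains 1/8, while
    the cubic term and the lower-order terms cost at most 1/32 each; 1/16 remains.\<close>
  define C2 where "C2 = c1 * L ^ 3 * \<tau>\<^sup>2 / 16"
  \<comment> \<open>Collects the bounds for the quadratic and linear parts of \<open>Psi_le\<close>,
    whose contribution is a K / a^2.\<close>
  define K where "K = L\<^sup>2 * (4 * c1 * \<tau>\<^sup>2 + 2 * d * \<tau>)"
  have \<tau>: "\<tau> > 0" using L c by (simp add: \<tau>_def)
  have d: "d > 0" using c by (simp add: d_def add_pos_nonneg)
  have "0 < (c1 * L) ^ 3 / c3\<^sup>2" using c L by simp
  moreover have "0 \<le> c1 * L * (norm B)\<^sup>2" using c L by simp
  ultimately have C1: "C1 > 0" unfolding C1_def using L by (intro mult_pos_pos add_pos_nonneg) auto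
  have C2: "C2 > 0" using c L \<tau> by (simp add: C2_def)
  have K: "K > 0" unfolding K_def using L c d \<tau> by (intro mult_pos_pos add_pos_pos) auto
  \<comment> \<open>The three thresholds give: \<open>a \<le> 1\<close>, to absorb terms with a
    milder power of \<open>a\<close>; norm B at most \<open>\<tau>\<close> / a; and a K at most c1
    L^3 \<open>\<tau>\<close>^2 / 32.\<close>
  define a0 where "a0 = min 1 (min (\<tau> / (norm B + 1)) (c1 * L ^ 3 * \<tau>\<^sup>2 / 32 / K))"
  have a0: "a0 > 0" using \<tau> K c L by (simp add: a0_def add_nonneg_pos)
  have main: "ereal (- C1 / a\<^sup>2) \<le> (INF h \<in> X_space L B. energy L B c1 c2 c3 \<gamma>0 a h) \<and>
           (INF h \<in> X_space L B. energy L B c1 c2 c3 \<gamma>0 a h) \<le> ereal (- C2 / a\<^sup>2)"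
    if a: "0 < a" "a < a0" for a
  proof
    have "a < \<tau> / (norm B + 1)" "norm B + 1 > 0" using a by (simp_all add: a0_def add_nonneg_pos)
    then have aB: "a * (norm B + 1) \<le> \<tau>" by (simp add: pos_less_divide_eq)
    have a1: "a \<le> 1" and aK: "a * K \<le> c1 * L ^ 3 * \<tau>\<^sup>2 / 32"
      using a K by (auto simp: a0_def field_simps)
    have a2: "a\<^sup>2 > 0" "a\<^sup>2 \<le> 1" using a a1 by (auto simp: power_le_one)
    have "((c1 * L) ^ 3 / (a * c3)\<^sup>2 + c1 * L * (norm B)\<^sup>2) * L\<^sup>2 \<le> C1 / a\<^sup>2"
    proof -
      have "c1 * L * (norm B)\<^sup>2 * a\<^sup>2 \<le> c1 * L * (norm B)\<^sup>2 * 1"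
        using a2 c L by (intro mult_left_mono) auto
      then have "c1 * L * (norm B)\<^sup>2 \<le> c1 * L * (norm B)\<^sup>2 / a\<^sup>2" using a2 by (simp add: field_simps)
      then have "(c1 * L) ^ 3 / (a * c3)\<^sup>2 + c1 * L * (norm B)\<^sup>2 \<le> ((c1 * L) ^ 3 / c3\<^sup>2 + c1 * L * (norm B)\<^sup>2) / a\<^sup>2"
        using a c by (simp add: power_mult_distrib add_divide_distrib mult.commute)
      then have "((c1 * L) ^ 3 / (a * c3)\<^sup>2 + c1 * L * (norm B)\<^sup>2) * L\<^sup>2 \<le>
          ((c1 * L) ^ 3 / c3\<^sup>2 + c1 * L * (norm B)\<^sup>2) / a\<^sup>2 * L\<^sup>2"
        by (rule mult_right_mono) simp
      then show ?thesis by (simp add: C1_def)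
    qed
    then have "ereal (- C1 / a\<^sup>2) \<le> ereal (- (((c1 * L) ^ 3 / (a * c3)\<^sup>2 + c1 * L * (norm B)\<^sup>2) * L\<^sup>2))"
      by simp
    then show "ereal (- C1 / a\<^sup>2) \<le> (INF h \<in> X_space L B. energy L B c1 c2 c3 \<gamma>0 a h)"
      using order_trans energy_lower_bound[OF L c a(1)] by (intro INF_greatest) blast
    \<comment> \<open>Chosen so that the ripple has maximal slope \<open>\<tau>\<close> / a;
      \<open>M\<close> below doubles this to make room for \<open>B\<close>.\<close>
    define s where "s = L * \<tau> / (2 * pi * a)"
    define M where "M = 2 * \<tau> / a"
    have s: "s > 0" using L \<tau> a by (simp add: s_def)
    have "s * (2 * pi / L) = \<tau> / a" using L a by (simp add: s_def)
    moreover have "norm B \<le> \<tau> / a" using aB a by (simp add: field_simps)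
    ultimately have M: "s * (2 * pi / L) + norm B \<le> M" by (simp add: M_def)
    have e1: "a * c1 * M\<^sup>2 = (4 * c1 * \<tau>\<^sup>2 * a) / a\<^sup>2"
      using a by (simp add: M_def power2_eq_square field_simps)
    \<comment> \<open>The linear part is bounded independently of \<open>a\<close>; it is weakened
      to order 1/a so that it fits into \<open>K\<close>.\<close>
    have e2: "a * d * M \<le> (2 * d * \<tau> * a) / a\<^sup>2"
    proof -
      have "2 * d * \<tau> * a \<le> 2 * d * \<tau>" using a1 d \<tau> a by (simp add: mult_left_le)
      then show ?thesis using a by (simp add: M_def power2_eq_square field_simps)
    qed
    have e3: "a * c3 * M ^ 3 = 8 * c3 * \<tau> ^ 3 / a\<^sup>2"
      using a by (simp add: M_def power2_eq_square power3_eq_cube field_simps)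
    have e4: "- 2 * c1 * pi\<^sup>2 * L * (s / 2)\<^sup>2 = (- c1 * L ^ 3 * \<tau>\<^sup>2 / 8) / a\<^sup>2"
      using a by (simp add: s_def power2_eq_square power3_eq_cube field_simps)
    have e5: "8 * c3 * \<tau> ^ 3 * L\<^sup>2 = c1 * L ^ 3 * \<tau>\<^sup>2 / 32"
      using c by (simp add: \<tau>_def power2_eq_square power3_eq_cube field_simps)
    have "- 2 * c1 * pi\<^sup>2 * L * (s / 2)\<^sup>2 + (a * c1 * M\<^sup>2 + a * d * M + a * c3 * M ^ 3) * L\<^sup>2
      \<le> (- c1 * L ^ 3 * \<tau>\<^sup>2 / 8) / a\<^sup>2 + ((4 * c1 * \<tau>\<^sup>2 * a) / a\<^sup>2 + (2 * d * \<tau> * a) / a\<^sup>2 + 8 * c3 * \<tau> ^ 3 / a\<^sup>2) * L\<^sup>2"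
      unfolding e1 e3 e4 using e2 by (intro add_mono mult_right_mono) auto
    also have "\<dots> = (- c1 * L ^ 3 * \<tau>\<^sup>2 / 8 + (a * K + 8 * c3 * \<tau> ^ 3 * L\<^sup>2)) / a\<^sup>2"
      by (simp add: K_def add_divide_distrib diff_divide_distrib algebra_simps)
    also have "\<dots> \<le> - C2 / a\<^sup>2"
      using aK e5 by (intro divide_right_mono) (auto simp: C2_def)
    finally have "energy L B c1 c2 c3 \<gamma>0 a (\<lambda>x. ripple L s x + B \<bullet> x) \<le> ereal (- C2 / a\<^sup>2)"
      using energy_ripple_le[OF L c a(1) s M] unfolding d_def[symmetric]
      by (meson ereal_less_eq(3) order_trans)
    then show "(INF h \<in> X_space L B. energy L B c1 c2 c3 \<gamma>0 a h) \<le> ereal (- C2 / a\<^sup>2)"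
      by (rule INF_lower2[OF ripple_in_X_space[OF L]])
  qed
  have "\<forall>\<^sub>F a in at_right 0. 0 < a \<and> a < a0"
    using a0 by (auto simp: eventually_at_right_field)
  then have "\<forall>\<^sub>F a in at_right 0. ereal (- C1 / a\<^sup>2) \<le> (INF h \<in> X_space L B. energy L B c1 c2 c3 \<gamma>0 a h) \<and>
           (INF h \<in> X_space L B. energy L B c1 c2 c3 \<gamma>0 a h) \<le> ereal (- C2 / a\<^sup>2)"
    by (rule eventually_mono) (use main in blast)
  with C1 C2 show ?thesis by blast
qed

end
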